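(* There is a constant $C$, independent of $u$, such that the following holds. Let $u:B(0,1)\subset\mathbb{R}^2\to\mathbb{R}$ be an axisymmetric function such that, as a function of $r$, $u\in BV(0,1)$ and $\operatorname{supp}(u)\subset[0,1)$. If $\mathcal{A}u=f$, then $$\|u\|_{L^2(B(0,1))}\le C\,\|u\|_{TV(0,1)}^{1/2}\,\|f\|_{L^2(0,1)}^{1/2}.$$
   Context: $B(0,1)$ is the unit ball of $\mathbb{R}^2$. A function $u$ on $B(0,1)$ is axisymmetric if it depends only on $r=\sqrt{x^2+y^2}$; its radial profile is also written $u(r)$, and $u$ is extended by zero for $r\ge 1$. The Abel transform of $u$ is $$\mathcal{A}u(x):=2\int_x^\infty\frac{u(r)\,r}{\sqrt{r^2-x^2}}\,dr,\qquad x\ge 0 .$$ The norm on the left is $\|u\|_{L^2(B(0,1))}:=\left(\iint_{B(0,1)}|u(x,y)|^2\,dx\,dy\right)^{1/2}$. The total variation of the radial profile is $$\|u\|_{TV(0,1)}:=\sup\left\{\int_0^1 u(r)\,\phi'(r)\,dr:\ \phi\in C_c^1((0,1);\mathbb{R}),\ \|\phi\|_{L^\infty(0,1)}\le 1\right\}.$$ *)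

theory Defs
  imports "HOL-Analysis.Analysis"
begin

definition axisymmetric :: "(real^2 \<Rightarrow> real) \<Rightarrow> bool" where
  "axisymmetric u \<longleftrightarrow> (\<exists>v. \<forall>p\<in>ball 0 1. u p = v (norm p))"

text \<open>Only the values of \<open>u\<close> on the unit ball enter; the profile is extended by zero to
  \<open>r \<ge> 1\<close> (and to \<open>r < 0\<close>, where it has no meaning).\<close>

definition radial_profile :: "(real^2 \<Rightarrow> real) \<Rightarrow> real \<Rightarrow> real" where
  "radial_profile u r = (if 0 \<le> r \<and> r < 1 then u (r *\<^sub>R axis 1 1) else 0)"

definition abel_transform :: "(real \<Rightarrow> real) \<Rightarrow> real \<Rightarrow> real" where
  "abel_transform v x = 2 * (LINT r:{x<..}|lebesgue. v r * r / sqrt (r\<^sup>2 - x\<^sup>2))"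

text \<open>Functions in \<open>C\<^sub>c\<^sup>1((0,1))\<close> are identified with their extensions by zero; the closure
  of the nonzero set is taken in the whole real line, so it is automatically compact.\<close>

definition tv_test_functions :: "(real \<Rightarrow> real) set" where
  "tv_test_functions = {\<phi>. \<phi> C1_differentiable_on UNIV \<and>
     closure {r. \<phi> r \<noteq> 0} \<subseteq> {0<..<1} \<and> (\<forall>r\<in>{0<..<1}. \<bar>\<phi> r\<bar> \<le> 1)}"

text \<open>The coercion \<open>ennreal\<close> truncates negative numbers to \<open>0\<close>; this does not affect the
  supremum, since the test function \<open>\<phi> = 0\<close> already contributes the value \<open>0\<close>.\<close>

definition TV_norm :: "(real \<Rightarrow> real) \<Rightarrow> ennreal" where
  "TV_norm v = (SUP \<phi>\<in>tv_test_functions.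
     ennreal (LINT r:{0<..<1}|lebesgue. v r * deriv \<phi> r))"

definition BV :: "(real \<Rightarrow> real) \<Rightarrow> bool" where
  "BV v \<longleftrightarrow> set_integrable lebesgue {0<..<1} v \<and> TV_norm v < \<infinity>"

definition ennreal_sqrt :: "ennreal \<Rightarrow> ennreal" where
  "ennreal_sqrt a = (if a = \<infinity> then \<infinity> else ennreal (sqrt (enn2real a)))"

definition L2_norm :: "'a::euclidean_space set \<Rightarrow> ('a \<Rightarrow> real) \<Rightarrow> ennreal" where
  "L2_norm S g = ennreal_sqrt (\<integral>\<^sup>+x\<in>S. ennreal (\<bar>g x\<bar>\<^sup>2) \<partial>lebesgue)"

end

theory Submission
  imports Defs "HOL-Real_Asymp.Real_Asymp"
begin

text \<open>
The change of variables \<open>s = r\<^sup>2\<close> makes the problem translation invariant. Put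
\<open>w(s) = u(\<surd>s)\<close>, where \<open>u\<close> is the radial profile. Then \<open>f(x) = F(x\<^sup>2)\<close>, where
\<open>F(t) = \<integral>\<^sub>t w(s) (s - t)\<^bsup>-1/2\<^esup> ds\<close> is a half-integral of \<open>w\<close>; the square of the norm of \<open>u\<close> on
the disc is \<open>\<pi> \<integral> w\<^sup>2\<close>, and \<open>\<integral>\<^sub>0\<^sup>1 F\<^sup>2 \<le> 2 \<integral>\<^sub>0\<^sup>1 f\<^sup>2\<close>. Since the total variation \<open>V\<close> does not depend on
the parametrisation, it suffices to prove \<open>\<integral> w\<^sup>2 \<le> 6 V \<Phi>\<close> whenever \<open>\<integral>\<^sub>0\<^sup>1 F\<^sup>2 \<le> \<Phi>\<^sup>2\<close>.

This is an interpolation inequality: \<open>w\<close> has \<open>1/2\<close> derivative in \<open>L\<^sup>2\<close> (in a weak sense, as a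
function of bounded variation), and \<open>-1/2\<close> derivative in \<open>L\<^sup>2\<close> by the bound on \<open>F\<close>. Accordingly
\<open>w\<close> is compared with its average \<open>w\<^sub>h\<close> over \<open>(s, s + h)\<close>, and \<open>\<integral> w\<^sup>2 = \<integral> w (w - w\<^sub>h) + \<integral> w w\<^sub>h\<close>.

\<^item> The primitive of \<open>w - w\<^sub>h\<close> is at most \<open>2hV\<close>, because the primitive of \<open>w\<close> is Lipschitz with
  constant \<open>sup |w| \<le> V\<close>. Testing the total variation of \<open>w\<close> against this primitive gives
  \<open>\<integral> w (w - w\<^sub>h) \<le> 2hV\<^sup>2\<close> (\<open>abs_integral_minus_forward_average_le\<close>).

\<^item> Half-integrating \<open>F\<close> once more inverts the Abel transform: it gives \<open>\<pi>\<close> times the tail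
  \<open>\<integral>\<^sub>x w\<close>. So \<open>w\<^sub>h\<close> is \<open>F\<close> convolved with \<open>k(y) / (\<pi>h)\<close>, where \<open>k\<close> is the difference between
  \<open>y\<^bsup>-1/2\<^esup>\<close> and its translate by \<open>h\<close>. Its \<open>L\<^sup>1\<close> norm is \<open>4\<surd>h\<close>, and Young's inequality in
  bilinear form yields \<open>\<integral> w w\<^sub>h \<le> \<integral> w\<^sup>2 / 2 + \<Phi>\<^sup>2 / h\<close>
  (\<open>integral_mult_forward_average_le\<close>).

The half of \<open>\<integral> w\<^sup>2\<close> is absorbed on the left, and \<open>h = \<Phi> / V\<close> balances the two remaining terms
(\<open>integral_square_le\<close>).

The definition of the total variation only admits \<open>C\<^sup>1\<close> test functions with compact support in
\<open>(0,1)\<close>, whereas the argument above uses primitives of bounded measurable functions, which vanish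
at \<open>0\<close> but not near it. \<open>tv_pairing_le_of_test_functions\<close> bridges this gap by approximation; the
support of the profile stays away from \<open>1\<close>, which leaves room for a cutoff.
The same pairing, with the test function running over primitives of indicators, also shows \<open>|u| \<le> V\<close> almost everywhere.
\<close>
section \<open>The Abel kernel\<close>

text \<open>Integrals of the Abel kernel are improper, so the fundamental theorem of calculus is
  needed with one-sided limits of the primitive at the end points, possibly at infinity.\<close>
lemma nn_integral_einterval_FTC:
  fixes f F :: "real \<Rightarrow> real" and a b :: ereal
  assumes "a < b"
    and F: "\<And>x. a < ereal x \<Longrightarrow> ereal x < b \<Longrightarrow> (F has_real_derivative f x) (at x)"
    and cont: "\<And>x. a < ereal x \<Longrightarrow> ereal x < b \<Longrightarrow> isCont f x"
    and nonneg: "\<And>x. a < ereal x \<Longrightarrow> ereal x < b \<Longrightarrow> 0 \<le> f x"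
    and A: "((F \<circ> real_of_ereal) \<longlongrightarrow> A) (at_right a)"
    and B: "((F \<circ> real_of_ereal) \<longlongrightarrow> B) (at_left b)"
  shows "(\<integral>\<^sup>+x\<in>einterval a b. ennreal (f x) \<partial>lborel) = ennreal (B - A)"
proof -
  have int: "set_integrable lborel (einterval a b) f" and val: "(LBINT x=a..b. f x) = B - A"
    using interval_integral_FTC_nonneg[OF assms(1) F cont _ A B] nonneg by auto
  have "(\<integral>\<^sup>+x\<in>einterval a b. ennreal (f x) \<partial>lborel)
      = (\<integral>\<^sup>+x. ennreal (indicator (einterval a b) x *\<^sub>R f x) \<partial>lborel)"
    by (rule nn_integral_cong) (auto simp: indicator_def)
  also have "\<dots> = ennreal (\<integral>x. indicator (einterval a b) x *\<^sub>R f x \<partial>lborel)"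
    using int nonneg unfolding set_integrable_def
    by (intro nn_integral_eq_integral AE_I2) (auto simp: indicator_def einterval_def)
  also have "(\<integral>x. indicator (einterval a b) x *\<^sub>R f x \<partial>lborel) = B - A"
    using val assms(1) by (simp add: interval_lebesgue_integral_def set_lebesgue_integral_def split: if_splits)
  finally show ?thesis .
qed

definition abel_kernel :: "real \<Rightarrow> real" where
  "abel_kernel y = (if 0 < y then 1 / sqrt y else 0)"

lemma abel_kernel_measurable [measurable]: "abel_kernel \<in> borel_measurable borel"
  unfolding abel_kernel_def by measurable

lemma abel_kernel_nonneg [simp]: "0 \<le> abel_kernel y"
  by (simp add: abel_kernel_def)

lemma nn_integral_abel_kernel:
  assumes "0 < h"
  shows "(\<integral>\<^sup>+y\<in>{0<..<h}. ennreal (abel_kernel y) \<partial>lborel) = ennreal (2 * sqrt h)"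
proof -
  have "(\<integral>\<^sup>+y\<in>einterval 0 h. ennreal (1 / sqrt y) \<partial>lborel) = ennreal (2 * sqrt h - 0)"
  proof (rule nn_integral_einterval_FTC[where F = "\<lambda>y. 2 * sqrt y"])
    show "(((\<lambda>y. 2 * sqrt y) \<circ> real_of_ereal) \<longlongrightarrow> 0) (at_right 0)"
      unfolding zero_ereal_def ereal_tendsto_simps1 by (rule tendsto_eq_intros | simp)+
    show "(((\<lambda>y. 2 * sqrt y) \<circ> real_of_ereal) \<longlongrightarrow> 2 * sqrt h) (at_left (ereal h))"
      unfolding ereal_tendsto_simps1 by (rule tendsto_eq_intros | simp)+
  qed (use assms in \<open>auto intro!: derivative_eq_intros continuous_intros simp: field_simps\<close>)
  also have "(\<integral>\<^sup>+y\<in>einterval 0 h. ennreal (1 / sqrt y) \<partial>lborel)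
      = (\<integral>\<^sup>+y\<in>{0<..<h}. ennreal (abel_kernel y) \<partial>lborel)"
    by (rule nn_integral_cong) (auto simp: indicator_def einterval_def abel_kernel_def)
  finally show ?thesis by simp
qed

text \<open>The difference is positive on \<open>(0, h)\<close> and negative beyond, and each part contributes
  \<open>2 * sqrt h\<close>. The growth like \<open>sqrt h\<close> rather than \<open>h\<close> is what half a derivative amounts to.\<close>
lemma nn_integral_abel_kernel_diff:
  assumes "0 < h"
  shows "(\<integral>\<^sup>+y. ennreal \<bar>abel_kernel y - abel_kernel (y - h)\<bar> \<partial>lborel) = ennreal (4 * sqrt h)"
proof -
  let ?k = "\<lambda>y. ennreal \<bar>abel_kernel y - abel_kernel (y - h)\<bar>"
  have "(\<integral>\<^sup>+y\<in>einterval h \<infinity>. ennreal (1 / sqrt (y - h) - 1 / sqrt y) \<partial>lborel)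
      = ennreal (0 - - 2 * sqrt h)"
  proof (rule nn_integral_einterval_FTC[where F = "\<lambda>y. 2 * sqrt (y - h) - 2 * sqrt y"])
    show "(((\<lambda>y. 2 * sqrt (y - h) - 2 * sqrt y) \<circ> real_of_ereal) \<longlongrightarrow> - 2 * sqrt h)
        (at_right (ereal h))"
      unfolding ereal_tendsto_simps1 by (rule tendsto_eq_intros | simp)+
    have "((\<lambda>y. 2 * sqrt (y - h) - 2 * sqrt y) \<longlongrightarrow> 0) at_top"
      using assms by real_asymp
    then show "(((\<lambda>y. 2 * sqrt (y - h) - 2 * sqrt y) \<circ> real_of_ereal) \<longlongrightarrow> 0) (at_left \<infinity>)"
      unfolding ereal_tendsto_simps1 .
  qed (use assms in \<open>auto intro!: derivative_eq_intros continuous_intros frac_le simp: field_simps\<close>)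
  also have "(\<integral>\<^sup>+y\<in>einterval h \<infinity>. ennreal (1 / sqrt (y - h) - 1 / sqrt y) \<partial>lborel)
      = (\<integral>\<^sup>+y\<in>{h<..}. ?k y \<partial>lborel)"
  proof (rule nn_integral_cong)
    fix y :: real
    have "\<bar>1 / sqrt y - 1 / sqrt (y - h)\<bar> = 1 / sqrt (y - h) - 1 / sqrt y" if "h < y"
      using that assms by (subst abs_of_nonpos) (auto intro!: frac_le)
    then show "ennreal (1 / sqrt (y - h) - 1 / sqrt y) * indicator (einterval h \<infinity>) y
        = ?k y * indicator {h<..} y"
      using assms by (auto simp: indicator_def einterval_def abel_kernel_def)
  qed
  finally have right: "(\<integral>\<^sup>+y\<in>{h<..}. ?k y \<partial>lborel) = ennreal (2 * sqrt h)" by simp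
  have "(\<integral>\<^sup>+y\<in>{0<..<h}. ?k y \<partial>lborel)
      = (\<integral>\<^sup>+y\<in>{0<..<h}. ennreal (abel_kernel y) \<partial>lborel)"
    by (rule nn_integral_cong) (auto simp: indicator_def abel_kernel_def)
  then have left: "(\<integral>\<^sup>+y\<in>{0<..<h}. ?k y \<partial>lborel) = ennreal (2 * sqrt h)"
    using nn_integral_abel_kernel[OF assms] by simp
  have "(\<integral>\<^sup>+y. ?k y \<partial>lborel)
      = (\<integral>\<^sup>+y. ?k y * indicator {0<..<h} y + ?k y * indicator {h<..} y \<partial>lborel)"
    by (rule nn_integral_cong_AE)
      (use AE_lborel_singleton[of h] assms in
        \<open>auto elim!: eventually_mono simp: indicator_def abel_kernel_def\<close>)
  also have "\<dots> = ennreal (2 * sqrt h) + ennreal (2 * sqrt h)"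
    by (subst nn_integral_add) (auto simp: left right)
  also have "\<dots> = ennreal (4 * sqrt h)"
    using assms by (simp flip: ennreal_plus)
  finally show ?thesis .
qed

text \<open>The kernel is, up to a constant, that of integration of order one half; applied twice it
  is ordinary integration. The integral equals the Beta value \<open>B(1/2, 1/2) = \<pi>\<close>, with
  primitive \<open>arcsin\<close> after the affine map of \<open>[x, s]\<close> onto \<open>[-1, 1]\<close>.\<close>
lemma nn_integral_abel_kernel_conv:
  "(\<integral>\<^sup>+t. ennreal (abel_kernel (s - t) * abel_kernel (t - x)) \<partial>lborel)
    = ennreal pi * indicator {x<..} s"
proof (cases "x < s")
  case False
  then have z: "abel_kernel (s - t) * abel_kernel (t - x) = 0" for t
    by (auto simp: abel_kernel_def)
  show ?thesis unfolding z using False by simp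
next
  case True
  let ?G = "\<lambda>t. arcsin ((2 * t - s - x) / (s - x))"
  have "(\<integral>\<^sup>+t\<in>einterval x s. ennreal (1 / (sqrt (s - t) * sqrt (t - x))) \<partial>lborel)
      = ennreal (pi / 2 - - (pi / 2))"
  proof (rule nn_integral_einterval_FTC[where F = ?G])
    have c: "continuous_on {x..s} ?G"
      using True by (intro continuous_intros) (auto simp: divide_simps)
    have "(2 * x - s - x) / (s - x) = -1" "(2 * s - s - x) / (s - x) = 1"
      using True by (auto simp: divide_simps)
    then have m: "?G x = - (pi / 2)" "?G s = pi / 2"
      by (simp_all only: arcsin_minus_1 arcsin_1 minus_divide_left)
    have "(?G \<longlongrightarrow> ?G x) (at_right x)"
      using continuous_on_Icc_at_rightD[OF c True] .
    then show "((?G \<circ> real_of_ereal) \<longlongrightarrow> - (pi / 2)) (at_right (ereal x))"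
      unfolding ereal_tendsto_simps1 m .
    have "(?G \<longlongrightarrow> ?G s) (at_left s)"
      using continuous_on_Icc_at_leftD[OF c True] .
    then show "((?G \<circ> real_of_ereal) \<longlongrightarrow> pi / 2) (at_left (ereal s))"
      unfolding ereal_tendsto_simps1 m .
    fix t assume "ereal x < ereal t" "ereal t < ereal s"
    then have t: "x < t" "t < s" by auto
    let ?u = "(2 * t - s - x) / (s - x)"
    have u: "-1 < ?u" "?u < 1" using t by (auto simp: divide_simps)
    have "1 - ?u\<^sup>2 = (2 * sqrt (s - t) * sqrt (t - x) / (s - x))\<^sup>2"
      using t by (simp add: power_divide power_mult_distrib divide_simps)
        (simp add: power2_eq_square algebra_simps)
    then have sq: "sqrt (1 - ?u\<^sup>2) = 2 * sqrt (s - t) * sqrt (t - x) / (s - x)"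
      using t by (simp add: real_sqrt_unique)
    have "((\<lambda>t. (2 * t - s - x) / (s - x)) has_real_derivative 2 / (s - x)) (at t)"
      by (intro DERIV_cdivide) (auto intro!: derivative_eq_intros)
    from DERIV_chain2[OF DERIV_arcsin[OF u] this]
    have "(?G has_real_derivative inverse (sqrt (1 - ?u\<^sup>2)) * (2 / (s - x))) (at t)" .
    also have "inverse (sqrt (1 - ?u\<^sup>2)) * (2 / (s - x)) = 1 / (sqrt (s - t) * sqrt (t - x))"
      unfolding sq using t by (simp add: divide_simps)
    finally show "(?G has_real_derivative 1 / (sqrt (s - t) * sqrt (t - x))) (at t)" .
    show "isCont (\<lambda>t. 1 / (sqrt (s - t) * sqrt (t - x))) t"
      using t by (intro continuous_intros) auto
    show "0 \<le> 1 / (sqrt (s - t) * sqrt (t - x))" using t by simp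
  qed (use True in auto)
  also have "(\<integral>\<^sup>+t\<in>einterval x s. ennreal (1 / (sqrt (s - t) * sqrt (t - x))) \<partial>lborel)
      = (\<integral>\<^sup>+t. ennreal (abel_kernel (s - t) * abel_kernel (t - x)) \<partial>lborel)"
    by (rule nn_integral_cong) (auto simp: indicator_def einterval_def abel_kernel_def)
  finally show ?thesis using True by simp
qed

lemma has_bochner_integral_abel_kernel_conv:
  "has_bochner_integral lborel (\<lambda>t. abel_kernel (s - t) * abel_kernel (t - x))
    (pi * indicator {x<..} s)"
  by (rule has_bochner_integral_nn_integral)
    (auto simp: nn_integral_abel_kernel_conv indicator_def)

section \<open>Young's inequality as a bilinear estimate\<close>

text \<open>Young's inequality \<open>\<bar>\<integral>\<integral> a(x) b(t) k(t - x)\<bar> \<le> \<parallel>a\<parallel>\<^sub>2 \<parallel>b\<parallel>\<^sub>2 \<parallel>k\<parallel>\<^sub>1\<close>, before optimising over \<open>\<mu>\<close>: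
  by the inequality of arithmetic and geometric means and translation invariance, only the
  integral of \<open>\<bar>k\<bar>\<close> in one variable remains. With a free \<open>\<mu>\<close> one of the two squares can be made
  small enough to be absorbed.\<close>
lemma nn_integral_young_le:
  fixes a b k :: "real \<Rightarrow> real"
  assumes [measurable]: "a \<in> borel_measurable borel" "b \<in> borel_measurable borel"
      "k \<in> borel_measurable borel"
    and "0 < \<mu>"
  shows "(\<integral>\<^sup>+x. \<integral>\<^sup>+t. ennreal \<bar>a x * b t * k (t - x)\<bar> \<partial>lborel \<partial>lborel)
    \<le> (ennreal (\<mu> / 2) * (\<integral>\<^sup>+x. ennreal ((a x)\<^sup>2) \<partial>lborel)
        + ennreal (1 / (2 * \<mu>)) * (\<integral>\<^sup>+t. ennreal ((b t)\<^sup>2) \<partial>lborel))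
      * (\<integral>\<^sup>+y. ennreal \<bar>k y\<bar> \<partial>lborel)"
proof -
  let ?K = "\<integral>\<^sup>+y. ennreal \<bar>k y\<bar> \<partial>lborel"
  have amgm: "ennreal \<bar>a x * b t * k (t - x)\<bar>
      \<le> ennreal (\<mu> / 2) * ennreal ((a x)\<^sup>2) * ennreal \<bar>k (t - x)\<bar>
        + ennreal (1 / (2 * \<mu>)) * ennreal ((b t)\<^sup>2) * ennreal \<bar>k (t - x)\<bar>" for x t
  proof -
    have "0 \<le> (\<mu> * \<bar>a x\<bar> - \<bar>b t\<bar>)\<^sup>2" by simp
    then have "2 * \<mu> * (\<bar>a x\<bar> * \<bar>b t\<bar>) \<le> \<mu>\<^sup>2 * (a x)\<^sup>2 + (b t)\<^sup>2"
      by (simp add: power2_diff power_mult_distrib mult_ac)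
    then have "\<bar>a x\<bar> * \<bar>b t\<bar> \<le> \<mu> / 2 * (a x)\<^sup>2 + 1 / (2 * \<mu>) * (b t)\<^sup>2"
      using \<open>0 < \<mu>\<close> by (simp add: field_simps power2_eq_square)
    then have "\<bar>a x * b t * k (t - x)\<bar>
        \<le> (\<mu> / 2 * (a x)\<^sup>2 + 1 / (2 * \<mu>) * (b t)\<^sup>2) * \<bar>k (t - x)\<bar>"
      unfolding abs_mult by (intro mult_right_mono) auto
    then show ?thesis
      using \<open>0 < \<mu>\<close> by (simp add: distrib_right ennreal_leI flip: ennreal_mult ennreal_plus)
  qed
  have K1: "(\<integral>\<^sup>+t. ennreal \<bar>k (t - x)\<bar> \<partial>lborel) = ?K" for x
    using nn_integral_real_affine[of "\<lambda>y. ennreal \<bar>k y\<bar>" 1 "- x"] by simp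
  have K2: "(\<integral>\<^sup>+x. ennreal \<bar>k (t - x)\<bar> \<partial>lborel) = ?K" for t
    using nn_integral_real_affine[of "\<lambda>y. ennreal \<bar>k y\<bar>" "-1" t] by simp
  have "(\<integral>\<^sup>+x. \<integral>\<^sup>+t. ennreal \<bar>a x * b t * k (t - x)\<bar> \<partial>lborel \<partial>lborel)
      \<le> (\<integral>\<^sup>+x. \<integral>\<^sup>+t. ennreal (\<mu> / 2) * ennreal ((a x)\<^sup>2) * ennreal \<bar>k (t - x)\<bar>
        + ennreal (1 / (2 * \<mu>)) * ennreal ((b t)\<^sup>2) * ennreal \<bar>k (t - x)\<bar> \<partial>lborel \<partial>lborel)"
    by (intro nn_integral_mono amgm)
  also have "\<dots> = (\<integral>\<^sup>+x. \<integral>\<^sup>+t. ennreal (\<mu> / 2) * ennreal ((a x)\<^sup>2) * ennreal \<bar>k (t - x)\<bar> \<partial>lborel \<partial>lborel)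
      + (\<integral>\<^sup>+x. \<integral>\<^sup>+t. ennreal (1 / (2 * \<mu>)) * ennreal ((b t)\<^sup>2) * ennreal \<bar>k (t - x)\<bar> \<partial>lborel \<partial>lborel)"
    by (simp add: nn_integral_add)
  also have "(\<integral>\<^sup>+x. \<integral>\<^sup>+t. ennreal (\<mu> / 2) * ennreal ((a x)\<^sup>2) * ennreal \<bar>k (t - x)\<bar> \<partial>lborel \<partial>lborel)
      = ennreal (\<mu> / 2) * (\<integral>\<^sup>+x. ennreal ((a x)\<^sup>2) \<partial>lborel) * ?K"
    by (simp add: nn_integral_cmult nn_integral_multc K1)
  also have "(\<integral>\<^sup>+x. \<integral>\<^sup>+t. ennreal (1 / (2 * \<mu>)) * ennreal ((b t)\<^sup>2) * ennreal \<bar>k (t - x)\<bar> \<partial>lborel \<partial>lborel)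
      = (\<integral>\<^sup>+t. \<integral>\<^sup>+x. ennreal (1 / (2 * \<mu>)) * ennreal ((b t)\<^sup>2) * ennreal \<bar>k (t - x)\<bar> \<partial>lborel \<partial>lborel)"
    by (rule lborel_pair.Fubini') simp
  also have "\<dots> = ennreal (1 / (2 * \<mu>)) * (\<integral>\<^sup>+t. ennreal ((b t)\<^sup>2) \<partial>lborel) * ?K"
    by (simp add: nn_integral_cmult nn_integral_multc K2)
  finally show ?thesis by (simp add: distrib_right)
qed

section \<open>Functionals bounded by the total variation\<close>

text \<open>\<open>V\<close> bounds the total variation of \<open>v\<close> on \<open>(0,1)\<close>, tested against all functions
  \<open>\<integral>\<^sub>0\<^sup>r k\<close> with \<open>k\<close> bounded and measurable. Boundary values at \<open>1\<close> are not constrained, so a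
  jump of \<open>v\<close> to zero at \<open>1\<close> counts, whereas a jump at \<open>0\<close> does not.\<close>
definition tv_pairing_le :: "(real \<Rightarrow> real) \<Rightarrow> real \<Rightarrow> bool" where
  "tv_pairing_le v V \<longleftrightarrow> (\<forall>k K M. k \<in> borel_measurable borel \<longrightarrow> (\<forall>s. \<bar>k s\<bar> \<le> K) \<longrightarrow>
     (\<forall>s\<in>{0..1}. \<bar>\<integral>x. k x * indicator {0..s} x \<partial>lborel\<bar> \<le> M) \<longrightarrow>
     (\<integral>x. v x * k x \<partial>lborel) \<le> V * M)"

lemma tv_pairing_leD:
  assumes "tv_pairing_le v V" "k \<in> borel_measurable borel" "\<And>s. \<bar>k s\<bar> \<le> K"
    and "\<And>s. s \<in> {0..1} \<Longrightarrow> \<bar>\<integral>x. k x * indicator {0..s} x \<partial>lborel\<bar> \<le> M"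
  shows "(\<integral>x. v x * k x \<partial>lborel) \<le> V * M"
  using assms unfolding tv_pairing_le_def by blast

section \<open>Interpolation between bounded variation and a half-integral\<close>

definition half_integral :: "(real \<Rightarrow> real) \<Rightarrow> real \<Rightarrow> real" where
  "half_integral w t = (\<integral>s. w s * abel_kernel (s - t) \<partial>lborel)"

definition tail_integral :: "(real \<Rightarrow> real) \<Rightarrow> real \<Rightarrow> real" where
  "tail_integral w x = (\<integral>s. w s * indicator {x<..} s \<partial>lborel)"

lemma half_integral_measurable [measurable]:
  assumes [measurable]: "w \<in> borel_measurable borel"
  shows "half_integral w \<in> borel_measurable borel"
  unfolding half_integral_def by measurable

lemma tail_integral_measurable [measurable]:
  assumes [measurable]: "w \<in> borel_measurable borel"
  shows "tail_integral w \<in> borel_measurable borel"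
proof -
  have "tail_integral w = (\<lambda>x. \<integral>s. w s * (if x < s then 1 else 0) \<partial>lborel)"
    unfolding tail_integral_def by (intro ext Bochner_Integration.integral_cong) auto
  then show ?thesis by simp
qed

locale bounded_profile =
  fixes w :: "real \<Rightarrow> real" and V :: real
  assumes w_measurable [measurable]: "w \<in> borel_measurable borel"
    and w_bound: "\<And>s. \<bar>w s\<bar> \<le> V"
    and w_support: "\<And>s. s \<notin> {0<..<1} \<Longrightarrow> w s = 0"
begin

lemma V_nonneg: "0 \<le> V"
  using w_bound[of 0] by linarith

lemma integrable_mult_w:
  assumes [measurable]: "k \<in> borel_measurable borel" and "\<And>s. \<bar>k s\<bar> \<le> K"
  shows "integrable lborel (\<lambda>s. w s * k s)"
proof (rule Bochner_Integration.integrable_bound)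
  show "integrable lborel (\<lambda>s. V * K * indicator {0<..<1::real} s)" by simp
  show "AE s in lborel. norm (w s * k s) \<le> norm (V * K * indicator {0<..<1} s)"
  proof (rule AE_I2)
    fix s
    have "\<bar>w s\<bar> * \<bar>k s\<bar> \<le> V * K"
      using w_bound[of s] assms(2)[of s] V_nonneg by (intro mult_mono) auto
    then have "norm (w s * k s) \<le> V * K * indicator {0<..<1} s"
      using w_support[of s] by (auto simp: indicator_def abs_mult)
    also have "\<dots> \<le> norm (V * K * indicator {0<..<1} s)" by simp
    finally show "norm (w s * k s) \<le> norm (V * K * indicator {0<..<1} s)" .
  qed
qed simp

lemma integrable_w_square: "integrable lborel (\<lambda>s. (w s)\<^sup>2)"
  using integrable_mult_w[OF w_measurable w_bound] by (simp add: power2_eq_square)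

lemma integrable_tail: "integrable lborel (\<lambda>s. w s * indicator A s)" if [measurable]: "A \<in> sets borel"
  by (rule integrable_mult_w[where K = 1]) (auto simp: indicator_def)

lemma tail_integral_diff:
  assumes "a \<le> b"
  shows "tail_integral w a - tail_integral w b = (\<integral>s. w s * indicator {a<..b} s \<partial>lborel)"
proof -
  have "tail_integral w a - tail_integral w b
      = (\<integral>s. w s * indicator {a<..} s - w s * indicator {b<..} s \<partial>lborel)"
    unfolding tail_integral_def by (subst Bochner_Integration.integral_diff) (auto intro: integrable_tail)
  also have "\<dots> = (\<integral>s. w s * indicator {a<..b} s \<partial>lborel)"
    using assms by (intro Bochner_Integration.integral_cong) (auto simp: indicator_def)
  finally show ?thesis .
qed

lemma tail_integral_lipschitz: "\<bar>tail_integral w a - tail_integral w b\<bar> \<le> V * \<bar>a - b\<bar>"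
proof -
  have *: "\<bar>tail_integral w a - tail_integral w b\<bar> \<le> V * (b - a)" if "a \<le> b" for a b
  proof -
    have "\<bar>\<integral>s. w s * indicator {a<..b} s \<partial>lborel\<bar> \<le> (\<integral>s. V * indicator {a<..b} s \<partial>lborel)"
    proof (rule order_trans[OF integral_abs_bound integral_mono])
      show "\<bar>w s * indicator {a<..b} s\<bar> \<le> V * indicator {a<..b} s" for s
        using w_bound[of s] by (simp add: indicator_def)
      show "integrable lborel (\<lambda>s. V * indicator {a<..b} s)"
        using that by (intro integrable_mult_right integrable_real_indicator) auto
    qed (auto intro!: integrable_abs integrable_tail)
    then show ?thesis
      using that by (simp add: tail_integral_diff)
  qed
  show ?thesis
    using *[of a b] *[of b a] by (cases "a \<le> b") (auto simp: abs_minus_commute)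
qed

lemma continuous_on_tail_integral: "continuous_on A (tail_integral w)"
proof -
  have "V-lipschitz_on A (tail_integral w)"
    using tail_integral_lipschitz V_nonneg by (intro lipschitz_onI) (auto simp: dist_real_def)
  then show ?thesis by (rule lipschitz_on_continuous_on)
qed

text \<open>Abel inversion in integrated form: by Fubini, the half-integral of the half-integral is
  \<open>\<pi>\<close> times the tail. The indicator costs nothing, since the half-integral vanishes beyond \<open>1\<close>
  and the kernel vanishes for \<open>t \<le> x\<close>; it matters because only the values of the half-integral
  on \<open>(0,1)\<close> are controlled.\<close>
lemma tail_integral_eq_half_integral:
  assumes "0 \<le> x"
  defines "g \<equiv> \<lambda>t. half_integral w t * indicator {0<..<1} t * abel_kernel (t - x)"
  shows "has_bochner_integral lborel g (pi * tail_integral w x)"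
proof -
  let ?f = "\<lambda>s t. w s * (abel_kernel (s - t) * abel_kernel (t - x))"
  note conv = has_bochner_integral_abel_kernel_conv[of _ x]
  have inner: "(\<integral>t. \<bar>?f s t\<bar> \<partial>lborel) = \<bar>w s * (pi * indicator {x<..} s)\<bar>"
    "(\<integral>t. ?f s t \<partial>lborel) = pi * (w s * indicator {x<..} s)" for s
    using has_bochner_integral_integral_eq[OF conv[of s]] by (simp_all add: abs_mult)
  have "integrable lborel (\<lambda>s. \<bar>w s * (pi * indicator {x<..} s)\<bar>)"
    by (intro integrable_abs integrable_mult_w[where K = pi]) (auto simp: indicator_def)
  then have f: "integrable (lborel \<Otimes>\<^sub>M lborel) (case_prod ?f)"
    by (intro lborel_pair.Fubini_integrable AE_I2)
      (auto simp: inner intro!: integrable_mult_right integrable.intros[OF conv])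
  have g: "(\<integral>s. ?f s t \<partial>lborel) = g t" for t
  proof -
    have "(\<integral>s. ?f s t \<partial>lborel) = half_integral w t * abel_kernel (t - x)"
      unfolding half_integral_def by (simp flip: mult.assoc)
    moreover have "half_integral w t = 0" if "1 \<le> t"
    proof -
      have z: "w s * abel_kernel (s - t) = 0" for s
        using that w_support[of s] by (auto simp: abel_kernel_def)
      show ?thesis unfolding half_integral_def z by simp
    qed
    moreover have "abel_kernel (t - x) = 0" if "t \<le> 0"
      using that assms(1) by (simp add: abel_kernel_def)
    ultimately show ?thesis
      unfolding g_def by (cases "t \<le> 0"; cases "1 \<le> t") (auto simp: indicator_def)
  qed
  have "integrable lborel g"
    using lborel_pair.integrable_snd[OF f] by (simp add: g)
  moreover have "integral\<^sup>L lborel g = pi * tail_integral w x"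
    using lborel_pair.Fubini_integral[OF f] unfolding g inner tail_integral_def by simp
  ultimately show ?thesis by (simp add: has_bochner_integral_iff)
qed

lemma abs_tail_integral_diff_le:
  assumes "0 \<le> x" "0 \<le> h"
  shows "ennreal \<bar>tail_integral w x - tail_integral w (x + h)\<bar>
    \<le> ennreal (1 / pi) * (\<integral>\<^sup>+t. ennreal \<bar>half_integral w t * indicator {0<..<1} t
          * (abel_kernel (t - x) - abel_kernel (t - x - h))\<bar> \<partial>lborel)" (is "_ \<le> _ * ?I")
proof -
  let ?g = "\<lambda>t. half_integral w t * indicator {0<..<1} t
      * (abel_kernel (t - x) - abel_kernel (t - x - h))"
  have "has_bochner_integral lborel ?g
      (pi * tail_integral w x - pi * tail_integral w (x + h))"
    using has_bochner_integral_diff[OF tail_integral_eq_half_integral[of x]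
        tail_integral_eq_half_integral[of "x + h"]] assms
    by (simp add: right_diff_distrib diff_diff_eq)
  then have i: "integrable lborel ?g"
    and v: "integral\<^sup>L lborel ?g = pi * (tail_integral w x - tail_integral w (x + h))"
    by (auto simp: has_bochner_integral_iff right_diff_distrib)
  have "ennreal (pi * \<bar>tail_integral w x - tail_integral w (x + h)\<bar>) \<le> ?I"
    using integral_norm_bound_ennreal[OF i] unfolding v by (simp add: abs_mult)
  then have "ennreal (1 / pi) * ennreal (pi * \<bar>tail_integral w x - tail_integral w (x + h)\<bar>)
      \<le> ennreal (1 / pi) * ?I"
    by (rule mult_left_mono) simp
  then show ?thesis by (simp flip: ennreal_mult)
qed

text \<open>The average of \<open>w\<close> over \<open>(x, x + h)\<close>, written with the tail so that Abel inversion
  applies to it directly.\<close>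
definition forward_average :: "real \<Rightarrow> real \<Rightarrow> real" where
  "forward_average h x = (tail_integral w x - tail_integral w (x + h)) / h"

lemma forward_average_measurable [measurable]: "forward_average h \<in> borel_measurable borel"
  unfolding forward_average_def by measurable

lemma abs_forward_average_le: "0 < h \<Longrightarrow> \<bar>forward_average h x\<bar> \<le> V"
  using tail_integral_lipschitz[of x "x + h"]
  by (simp add: forward_average_def field_simps)

text \<open>The average is the convolution of the half-integral with a kernel of \<open>L\<^sup>1\<close> norm
  \<open>4 / (\<pi> * sqrt h)\<close>, so Young's inequality applies.\<close>
lemma integral_mult_forward_average_le:
  assumes h: "0 < h"
    and \<Phi>: "0 \<le> \<Phi>" "(\<integral>\<^sup>+t\<in>{0<..<1}. ennreal ((half_integral w t)\<^sup>2) \<partial>lborel) \<le> ennreal (\<Phi>\<^sup>2)"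
  shows "(\<integral>x. w x * forward_average h x \<partial>lborel)
    \<le> (\<integral>x. (w x)\<^sup>2 \<partial>lborel) / 2 + \<Phi>\<^sup>2 / h"
proof -
  define X where "X = (\<integral>x. (w x)\<^sup>2 \<partial>lborel)"
  \<comment> \<open>This value makes the coefficient of \<open>X\<close> exactly \<open>1/2\<close>.\<close>
  define \<mu> where "\<mu> = pi * sqrt h / 4"
  have \<mu>: "0 < \<mu>" using h by (simp add: \<mu>_def)
  have X0: "0 \<le> X" by (simp add: X_def)
  let ?F = "\<lambda>t. half_integral w t * indicator {0<..<1} t"
  let ?k = "\<lambda>y. abel_kernel y - abel_kernel (y - h)"
  have F2: "(\<integral>\<^sup>+t. ennreal ((?F t)\<^sup>2) \<partial>lborel) \<le> ennreal (\<Phi>\<^sup>2)"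
  proof -
    have "(\<integral>\<^sup>+t. ennreal ((?F t)\<^sup>2) \<partial>lborel)
        = (\<integral>\<^sup>+t\<in>{0<..<1}. ennreal ((half_integral w t)\<^sup>2) \<partial>lborel)"
      by (rule nn_integral_cong) (auto simp: indicator_def)
    with \<Phi>(2) show ?thesis by simp
  qed
  have X2: "(\<integral>\<^sup>+x. ennreal ((w x)\<^sup>2) \<partial>lborel) = ennreal X"
    unfolding X_def by (rule nn_integral_eq_integral[OF integrable_w_square]) simp
  have "ennreal \<bar>\<integral>x. w x * forward_average h x \<partial>lborel\<bar>
      \<le> (\<integral>\<^sup>+x. ennreal \<bar>w x * forward_average h x\<bar> \<partial>lborel)"
    using integral_norm_bound_ennreal[OF integrable_mult_w[OF _ abs_forward_average_le[OF h]]]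
    by simp
  also have "\<dots> \<le> (\<integral>\<^sup>+x. ennreal (1 / (pi * h)) * (\<integral>\<^sup>+t. ennreal \<bar>w x * ?F t * ?k (t - x)\<bar> \<partial>lborel) \<partial>lborel)"
  proof (rule nn_integral_mono)
    fix x
    show "ennreal \<bar>w x * forward_average h x\<bar>
        \<le> ennreal (1 / (pi * h)) * (\<integral>\<^sup>+t. ennreal \<bar>w x * ?F t * ?k (t - x)\<bar> \<partial>lborel)"
    proof (cases "0 < x")
      case False
      then show ?thesis using w_support[of x] by simp
    next
      case True
      have "ennreal \<bar>w x * forward_average h x\<bar>
          = ennreal (\<bar>w x\<bar> / h) * ennreal \<bar>tail_integral w x - tail_integral w (x + h)\<bar>"
        using h by (simp add: forward_average_def abs_mult flip: ennreal_mult)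
      also have "\<dots> \<le> ennreal (\<bar>w x\<bar> / h) * (ennreal (1 / pi) * (\<integral>\<^sup>+t. ennreal \<bar>?F t * ?k (t - x)\<bar> \<partial>lborel))"
        using True h by (intro mult_left_mono abs_tail_integral_diff_le) auto
      also have "\<dots> = ennreal (1 / (pi * h)) * (ennreal \<bar>w x\<bar> * (\<integral>\<^sup>+t. ennreal \<bar>?F t * ?k (t - x)\<bar> \<partial>lborel))"
        using h by (simp add: ennreal_mult mult_ac flip: mult.assoc)
          (simp add: mult_ac flip: ennreal_mult)
      also have "\<dots> = ennreal (1 / (pi * h)) * (\<integral>\<^sup>+t. ennreal \<bar>w x * ?F t * ?k (t - x)\<bar> \<partial>lborel)"
        by (simp add: abs_mult mult.assoc ennreal_mult flip: nn_integral_cmult)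
      finally show ?thesis .
    qed
  qed
  also have "\<dots> = ennreal (1 / (pi * h)) * (\<integral>\<^sup>+x. \<integral>\<^sup>+t. ennreal \<bar>w x * ?F t * ?k (t - x)\<bar> \<partial>lborel \<partial>lborel)"
    by (rule nn_integral_cmult) measurable
  also have "\<dots> \<le> ennreal (1 / (pi * h)) * ((ennreal (\<mu> / 2) * ennreal X + ennreal (1 / (2 * \<mu>)) * ennreal (\<Phi>\<^sup>2))
      * ennreal (4 * sqrt h))"
  proof (rule mult_left_mono)
    have "(\<integral>\<^sup>+x. \<integral>\<^sup>+t. ennreal \<bar>w x * ?F t * ?k (t - x)\<bar> \<partial>lborel \<partial>lborel)
      \<le> (ennreal (\<mu> / 2) * ennreal X + ennreal (1 / (2 * \<mu>)) * (\<integral>\<^sup>+t. ennreal ((?F t)\<^sup>2) \<partial>lborel))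
        * ennreal (4 * sqrt h)"
      using nn_integral_young_le[of w ?F ?k \<mu>] \<mu>
      by (simp only: X2 nn_integral_abel_kernel_diff[OF h]) simp
    also have "\<dots> \<le> (ennreal (\<mu> / 2) * ennreal X + ennreal (1 / (2 * \<mu>)) * ennreal (\<Phi>\<^sup>2))
        * ennreal (4 * sqrt h)"
      by (intro mult_right_mono add_left_mono mult_left_mono F2) auto
    finally show "(\<integral>\<^sup>+x. \<integral>\<^sup>+t. ennreal \<bar>w x * ?F t * ?k (t - x)\<bar> \<partial>lborel \<partial>lborel) \<le> \<dots>" .
  qed simp
  also have "\<dots> = ennreal (1 / (pi * h) * ((\<mu> / 2 * X + 1 / (2 * \<mu>) * \<Phi>\<^sup>2) * (4 * sqrt h)))"
    using h \<mu> X0 by (simp flip: ennreal_mult ennreal_plus)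
  finally have "(\<integral>x. w x * forward_average h x \<partial>lborel)
      \<le> 1 / (pi * h) * ((\<mu> / 2 * X + 1 / (2 * \<mu>) * \<Phi>\<^sup>2) * (4 * sqrt h))"
    using h \<mu> X0 by (subst (asm) ennreal_le_iff) auto
  also have "\<dots> = X / 2 + 8 / pi\<^sup>2 * (\<Phi>\<^sup>2 / h)"
  proof -
    obtain r where r: "h = r\<^sup>2" "0 < r" "sqrt h = r"
      using h by (metis real_sqrt_gt_zero real_sqrt_pow2 less_imp_le)
    show ?thesis unfolding \<mu>_def r(3) using r(1,2) by (simp add: field_simps power2_eq_square)
  qed
  also have "\<dots> \<le> X / 2 + 1 * (\<Phi>\<^sup>2 / h)"
  proof -
    have "3\<^sup>2 \<le> pi\<^sup>2" using pi_gt3 by (intro power_mono) auto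
    then have "8 / pi\<^sup>2 \<le> 1" by (simp add: field_simps)
    then show ?thesis using h by (intro add_left_mono mult_right_mono) auto
  qed
  finally show ?thesis by (simp add: X_def)
qed

text \<open>With \<open>W\<close> for the tail, the integral equals \<open>(W(0) - A(0)) - (W(s) - A(s))\<close>, where \<open>A(a)\<close>
  is the average of \<open>W\<close> over \<open>[a, a + h]\<close>: shifting the domain of integration turns the integral
  of a difference quotient into a difference of averages. Both brackets are at most \<open>h * V\<close>
  since \<open>W\<close> is Lipschitz.\<close>
lemma abs_integral_minus_forward_average_le:
  assumes h: "0 < h" and s: "0 \<le> s"
  shows "\<bar>\<integral>x. (w x - forward_average h x) * indicator {0..s} x \<partial>lborel\<bar> \<le> 2 * h * V"
proof -
  let ?W = "tail_integral w"
  have avg: "\<bar>h * ?W a - integral {a..a + h} ?W\<bar> \<le> h * (h * V)" for a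
  proof -
    have "norm (integral {a..a + h} (\<lambda>x. ?W a - ?W x)) \<le> (h * V) * (a + h - a)"
    proof (rule integral_bound)
      fix x assume x: "x \<in> {a..a + h}"
      have "\<bar>?W a - ?W x\<bar> \<le> V * \<bar>a - x\<bar>" by (rule tail_integral_lipschitz)
      also have "\<dots> \<le> V * h" using x V_nonneg by (intro mult_left_mono) auto
      finally show "norm (?W a - ?W x) \<le> h * V" by (simp add: mult.commute)
    qed (use h in \<open>auto intro!: continuous_intros continuous_on_tail_integral\<close>)
    moreover have "integral {a..a + h} (\<lambda>x. ?W a - ?W x) = h * ?W a - integral {a..a + h} ?W"
      using h by (subst Henstock_Kurzweil_Integration.integral_diff)
        (auto intro!: integrable_continuous_interval continuous_on_tail_integral)
    ultimately show ?thesis by (simp add: mult.commute)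
  qed
  have int: "?W integrable_on {a..b}" for a b
    by (intro integrable_continuous_interval continuous_on_tail_integral)
  have fa: "(\<integral>x. forward_average h x * indicator {0..s} x \<partial>lborel)
      = (integral {0..h} ?W - integral {s..s + h} ?W) / h"
  proof -
    have c: "continuous_on {0..s} (forward_average h)"
      unfolding forward_average_def[abs_def]
      using h by (intro continuous_intros continuous_on_compose2[OF continuous_on_tail_integral[of UNIV]]) auto
    have "(\<integral>x. forward_average h x * indicator {0..s} x \<partial>lborel)
        = integral {0..s} (forward_average h)"
      using set_borel_integral_eq_integral(2)[OF borel_integrable_atLeastAtMost'[OF c]]
      by (simp add: set_lebesgue_integral_def mult.commute)
    also have "\<dots> = integral {0..s} (\<lambda>x. ?W x - ?W (x + h)) / h"
      unfolding forward_average_def[abs_def] by (rule Henstock_Kurzweil_Integration.integral_divide)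
    also have "integral {0..s} (\<lambda>x. ?W x - ?W (x + h))
        = integral {0..s} ?W - integral {0..s} (\<lambda>x. ?W (x + h))"
      by (intro Henstock_Kurzweil_Integration.integral_diff integrable_continuous_interval
          continuous_on_compose2[OF continuous_on_tail_integral[of UNIV]] continuous_intros) auto
    also have "integral {0..s} (\<lambda>x. ?W (x + h)) = integral {h..s + h} ?W"
      using integral_shift_real_ivl[of h h "s + h" ?W] by simp
    also have "integral {0..s} ?W - integral {h..s + h} ?W
        = integral {0..h} ?W - integral {s..s + h} ?W"
      using Henstock_Kurzweil_Integration.integral_combine[of 0 s "s + h" ?W]
        Henstock_Kurzweil_Integration.integral_combine[of 0 h "s + h" ?W] h s int by simp
    finally show ?thesis .
  qed
  have "(\<integral>x. (w x - forward_average h x) * indicator {0..s} x \<partial>lborel)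
      = (\<integral>x. w x * indicator {0..s} x - forward_average h x * indicator {0..s} x \<partial>lborel)"
    by (simp add: left_diff_distrib)
  also have "\<dots> = (\<integral>x. w x * indicator {0..s} x \<partial>lborel)
      - (\<integral>x. forward_average h x * indicator {0..s} x \<partial>lborel)"
  proof (rule Bochner_Integration.integral_diff)
    show "integrable lborel (\<lambda>x. forward_average h x * indicator {0..s} x)"
    proof (rule Bochner_Integration.integrable_bound)
      show "integrable lborel (\<lambda>x. V * indicator {0..s} x)"
        using s by (intro integrable_mult_right integrable_real_indicator) auto
    qed (use V_nonneg in \<open>auto simp: indicator_def abs_forward_average_le[OF h]\<close>)
  qed (simp add: integrable_tail)
  also have "(\<integral>x. w x * indicator {0..s} x \<partial>lborel) = (\<integral>x. w x * indicator {0<..s} x \<partial>lborel)"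
    using w_support[of 0]
    by (intro Bochner_Integration.integral_cong) (auto simp: indicator_def less_le)
  also have "\<dots> = ?W 0 - ?W s" using s by (simp add: tail_integral_diff)
  also have "?W 0 - ?W s - (\<integral>x. forward_average h x * indicator {0..s} x \<partial>lborel)
      = ((h * ?W 0 - integral {0..h} ?W) - (h * ?W s - integral {s..s + h} ?W)) / h"
    unfolding fa using h by (simp add: field_simps)
  also have "\<bar>\<dots>\<bar> \<le> (h * (h * V) + h * (h * V)) / h"
  proof -
    have "\<bar>(h * ?W 0 - integral {0..h} ?W) - (h * ?W s - integral {s..s + h} ?W)\<bar>
        \<le> h * (h * V) + h * (h * V)"
      by (rule order_trans[OF abs_triangle_ineq4 add_mono])
        (use avg[of 0] avg[of s] in simp_all)
    from divide_right_mono[OF this, of h] show ?thesis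
      using h by (simp only: abs_divide abs_of_pos less_imp_le)
  qed
  also have "\<dots> = 2 * h * V" using h by (simp add: field_simps)
  finally show ?thesis .
qed

text \<open>The interpolation inequality between bounded variation and half an integral in \<open>L\<^sup>2\<close>. The
  constant is \<open>4 + 2\<close>, from \<open>X \<le> 4 * h * V\<^sup>2 + 2 * \<Phi>\<^sup>2 / h\<close> at \<open>h = \<Phi> / V\<close>.\<close>
theorem integral_square_le:
  assumes pairing: "tv_pairing_le w V"
    and \<Phi>: "0 \<le> \<Phi>" "(\<integral>\<^sup>+t\<in>{0<..<1}. ennreal ((half_integral w t)\<^sup>2) \<partial>lborel) \<le> ennreal (\<Phi>\<^sup>2)"
  shows "(\<integral>x. (w x)\<^sup>2 \<partial>lborel) \<le> 6 * V * \<Phi>"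
proof -
  define X where "X = (\<integral>x. (w x)\<^sup>2 \<partial>lborel)"
  have X0: "0 \<le> X" by (simp add: X_def)
  have le: "X \<le> 4 * h * V\<^sup>2 + 2 * \<Phi>\<^sup>2 / h" if h: "0 < h" for h
  proof -
    have "(\<integral>x. w x * (w x - forward_average h x) \<partial>lborel) \<le> V * (2 * h * V)"
    proof (rule tv_pairing_leD[OF pairing])
      show "\<bar>w s - forward_average h s\<bar> \<le> V + V" for s
        using w_bound[of s] abs_forward_average_le[OF h, of s] by linarith
    qed (auto intro: abs_integral_minus_forward_average_le[OF h])
    moreover have "(\<integral>x. w x * (w x - forward_average h x) \<partial>lborel)
        = X - (\<integral>x. w x * forward_average h x \<partial>lborel)"
      unfolding X_def right_diff_distrib power2_eq_square
      by (intro Bochner_Integration.integral_diff integrable_mult_w[OF _ w_bound]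
          integrable_mult_w[OF _ abs_forward_average_le[OF h]]) auto
    ultimately have "X \<le> V * (2 * h * V) + (X / 2 + \<Phi>\<^sup>2 / h)"
      using integral_mult_forward_average_le[OF h \<Phi>] unfolding X_def by linarith
    moreover have "V * (2 * h * V) = 2 * (h * V\<^sup>2)" "4 * h * V\<^sup>2 = 4 * (h * V\<^sup>2)"
      "2 * \<Phi>\<^sup>2 / h = 2 * (\<Phi>\<^sup>2 / h)"
      by (simp_all add: power2_eq_square)
    ultimately show ?thesis by linarith
  qed
  have "X \<le> 6 * V * \<Phi>"
  proof (cases "V = 0 \<or> \<Phi> = 0")
    case False
    then have "0 < V" "0 < \<Phi>" using V_nonneg \<Phi>(1) by auto
    then show ?thesis
      using le[of "\<Phi> / V"] by (simp add: power2_eq_square)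
  next
    case True
    then show ?thesis
    proof
      assume "V = 0"
      then show ?thesis using w_bound by (simp add: X_def)
    next
      assume [simp]: "\<Phi> = 0"
      \<comment> \<open>Let \<open>h\<close> tend to zero.\<close>
      have "X \<le> 0"
      proof (rule field_le_epsilon)
        fix e :: real assume "0 < e"
        have "4 * (e / (4 * (V\<^sup>2 + 1))) * V\<^sup>2 \<le> e"
          using \<open>0 < e\<close> by (simp add: field_simps add_pos_nonneg)
        with le[of "e / (4 * (V\<^sup>2 + 1))"] \<open>0 < e\<close> show "X \<le> 0 + e"
          by (auto simp: add_nonneg_pos zero_less_divide_iff)
      qed
      then show ?thesis by simp
    qed
  qed
  then show ?thesis by (simp add: X_def)
qed

end

section \<open>From smooth test functions to primitives of bounded functions\<close>

text \<open>Composing \<open>square_pos\<close> with itself gives a \<open>C\<^sup>1\<close> cutoff by the chain rule alone: gluing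
  of pieces is confined to the single point \<open>0\<close>.\<close>
definition square_pos :: "real \<Rightarrow> real" where
  "square_pos x = (max 0 x)\<^sup>2"

lemma square_pos_has_derivative: "(square_pos has_real_derivative 2 * max 0 x) (at x)"
proof -
  consider "x < 0" | "0 < x" | "x = 0" by linarith
  then show ?thesis
  proof cases
    case 1
    have "((\<lambda>_. 0) has_real_derivative 2 * max 0 x) (at x)" using 1 by simp
    then show ?thesis
      by (rule has_field_derivative_transform_within_open[of _ _ _ "{..<0}"])
        (use 1 in \<open>auto simp: square_pos_def\<close>)
  next
    case 2
    have "((\<lambda>x. x\<^sup>2) has_real_derivative 2 * max 0 x) (at x)"
      using 2 by (auto intro!: derivative_eq_intros)
    then show ?thesis
      by (rule has_field_derivative_transform_within_open[of _ _ _ "{0<..}"])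
        (use 2 in \<open>auto simp: square_pos_def\<close>)
  next
    case 3
    have "((\<lambda>h. (square_pos (0 + h) - square_pos 0) / h) \<longlongrightarrow> 0) (at 0)"
    proof (rule Lim_null_comparison)
      show "\<forall>\<^sub>F h in at 0. norm ((square_pos (0 + h) - square_pos 0) / h) \<le> \<bar>h\<bar>"
        by (rule always_eventually) (auto simp: square_pos_def max_def power2_eq_square)
    qed (intro tendsto_eq_intros | simp)+
    with 3 show ?thesis by (simp add: DERIV_def)
  qed
qed

definition cutoff :: "real \<Rightarrow> real \<Rightarrow> real \<Rightarrow> real" where
  "cutoff a b x = square_pos (1 - square_pos ((x - a) / (b - a)))"

definition cutoff_deriv :: "real \<Rightarrow> real \<Rightarrow> real \<Rightarrow> real" where
  "cutoff_deriv a b x = 2 * max 0 (1 - square_pos ((x - a) / (b - a)))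
     * (- (2 * max 0 ((x - a) / (b - a)) * (1 / (b - a))))"

lemma cutoff_has_derivative:
  assumes "a < b"
  shows "(cutoff a b has_real_derivative cutoff_deriv a b x) (at x)"
proof -
  have "((\<lambda>x. (x - a) / (b - a)) has_real_derivative 1 / (b - a)) (at x)"
    by (intro DERIV_cdivide) (auto intro!: derivative_eq_intros)
  from DERIV_chain2[OF square_pos_has_derivative this]
  have "((\<lambda>x. 1 - square_pos ((x - a) / (b - a))) has_real_derivative
      - (2 * max 0 ((x - a) / (b - a)) * (1 / (b - a)))) (at x)"
    by (auto intro!: derivative_eq_intros)
  from DERIV_chain2[OF square_pos_has_derivative this] show ?thesis
    unfolding cutoff_def[abs_def] cutoff_deriv_def .
qed

lemma continuous_on_cutoff: "a < b \<Longrightarrow> continuous_on A (cutoff a b)"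
  using cutoff_has_derivative
  by (meson DERIV_isCont continuous_at_imp_continuous_on)

lemma continuous_on_cutoff_deriv: "a < b \<Longrightarrow> continuous_on A (cutoff_deriv a b)"
  unfolding cutoff_deriv_def[abs_def] square_pos_def by (intro continuous_intros) auto

lemma cutoff_bounds: "0 \<le> cutoff a b x" "cutoff a b x \<le> 1"
  by (auto simp: cutoff_def square_pos_def max_def power_le_one)

lemma cutoff_eq_1: "a < b \<Longrightarrow> x \<le> a \<Longrightarrow> cutoff a b x = 1"
  and cutoff_deriv_eq_0: "a < b \<Longrightarrow> x \<le> a \<Longrightarrow> cutoff_deriv a b x = 0"
  by (auto simp: cutoff_def cutoff_deriv_def square_pos_def max_def field_simps)

lemma cutoff_eq_0:
  assumes "a < b" "b \<le> x"
  shows "cutoff a b x = 0"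
proof -
  have y: "1 \<le> (x - a) / (b - a)" using assms by (simp add: field_simps)
  then have "1 - square_pos ((x - a) / (b - a)) \<le> 0"
    using one_le_power[OF y, of 2] by (simp add: square_pos_def)
  then show ?thesis by (simp add: cutoff_def square_pos_def)
qed

lemma primitive_has_derivative:
  fixes k :: "real \<Rightarrow> real"
  assumes cont: "continuous_on UNIV k" and "0 < a" and zero: "\<And>x. x \<le> a \<Longrightarrow> k x = 0"
  shows "((\<lambda>r. integral {0..r} k) has_real_derivative k r) (at r)"
proof (cases "r < a")
  case True
  have "((\<lambda>_. 0) has_real_derivative k r) (at r)" using True zero[of r] by simp
  then show ?thesis
  proof (rule has_field_derivative_transform_within_open[of _ _ _ "{..<a}"])
    fix x assume "x \<in> {..<a}"
    then show "0 = integral {0..x} k"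
      by (intro integral_unique[OF has_integral_is_0, symmetric]) (auto intro!: zero)
  qed (use True in auto)
next
  case False
  have "((\<lambda>r. integral {0..r} k) has_real_derivative k r) (at r within {0..r + 1})"
    using False assms(2)
    by (intro integral_has_real_derivative continuous_on_subset[OF cont]) auto
  moreover have "r \<in> interior {0..r + 1}" using False assms(2) by simp
  ultimately show ?thesis by (metis at_within_interior)
qed

text \<open>The primitive of \<open>k\<close> need not return to zero, so it is cut off between \<open>R\<close> and \<open>1\<close>, where
  \<open>v\<close> vanishes: neither the values nor the derivative of the cutoff are seen by \<open>v\<close>.\<close>
lemma weak_variation_continuous:
  fixes v k :: "real \<Rightarrow> real"
  assumes v: "\<And>r. r \<notin> {0<..<R} \<Longrightarrow> v r = 0"
    and R: "0 < R" "R < 1"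
    and tv: "\<And>\<phi>. \<phi> \<in> tv_test_functions \<Longrightarrow> (\<integral>r. v r * deriv \<phi> r \<partial>lborel) \<le> V"
    and k: "continuous_on UNIV k" "0 < a" "\<And>x. x \<le> a \<Longrightarrow> k x = 0"
    and M: "0 < M" "\<And>r. \<bar>integral {0..r} k\<bar> \<le> M"
  shows "(\<integral>r. v r * k r \<partial>lborel) \<le> V * M"
proof -
  define b where "b = (1 + R) / 2"
  have b: "R < b" "b < 1" using R by (auto simp: b_def)
  let ?G = "\<lambda>r. integral {0..r} k"
  let ?\<phi> = "\<lambda>r. ?G r * cutoff R b r / M"
  let ?D = "\<lambda>r. (k r * cutoff R b r + cutoff_deriv R b r * ?G r) / M"
  have D: "(?\<phi> has_real_derivative ?D r) (at r)" for r
    by (intro DERIV_cdivide DERIV_mult primitive_has_derivative[OF k] cutoff_has_derivative b)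
  have G0: "?G r = 0" if "r \<le> a" for r
    using that k(3) by (intro integral_unique[OF has_integral_is_0]) auto
  have "continuous_on UNIV ?G"
    using primitive_has_derivative[OF k] by (meson DERIV_isCont continuous_at_imp_continuous_on)
  then have "continuous_on UNIV ?D"
    using b k(1) M(1) by (intro continuous_intros continuous_on_cutoff continuous_on_cutoff_deriv) auto
  then have "?\<phi> C1_differentiable_on UNIV"
    unfolding C1_differentiable_on_def
    using D by (intro exI[of _ ?D]) (auto simp: has_real_derivative_iff_has_vector_derivative)
  moreover have "closure {r. ?\<phi> r \<noteq> 0} \<subseteq> {0<..<1}"
  proof -
    have "{r. ?\<phi> r \<noteq> 0} \<subseteq> {a..b}"
    proof (rule subsetI, rule ccontr)
      fix r assume r: "r \<in> {r. ?\<phi> r \<noteq> 0}" "r \<notin> {a..b}"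
      then have "r \<le> a \<or> b \<le> r" by auto
      then have "?\<phi> r = 0" using G0[of r] cutoff_eq_0[OF b(1), of r] by auto
      with r(1) show False by simp
    qed
    then have "closure {r. ?\<phi> r \<noteq> 0} \<subseteq> {a..b}" by (simp add: closure_minimal)
    then show ?thesis using k(2) b(2) by auto
  qed
  moreover have "\<bar>?\<phi> r\<bar> \<le> 1" for r
  proof -
    have "\<bar>?G r\<bar> * \<bar>cutoff R b r\<bar> \<le> M * 1"
      using cutoff_bounds[of R b r] M(1) by (intro mult_mono M(2)) auto
    then show ?thesis using M(1) by (simp add: abs_mult)
  qed
  ultimately have "?\<phi> \<in> tv_test_functions" by (simp add: tv_test_functions_def)
  then have "(\<integral>r. v r * deriv ?\<phi> r \<partial>lborel) \<le> V" by (rule tv)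
  moreover have eq: "v r * deriv ?\<phi> r = v r * k r / M" for r
    using v[of r] DERIV_imp_deriv[OF D, of r] cutoff_eq_1[OF b(1), of r] cutoff_deriv_eq_0[OF b(1), of r]
    by (cases "r \<in> {0<..<R}") auto
  ultimately have "(\<integral>r. v r * k r \<partial>lborel) / M \<le> V"
    unfolding eq by simp
  then show ?thesis using M(1) by (simp add: pos_divide_le_eq)
qed

text \<open>Almost everywhere approximation by continuous functions, preserving the bound (by
  truncating at \<open>K\<close>) and forcing zeros near \<open>0\<close> and beyond \<open>R\<close> (by multiplying with piecewise
  linear functions that increase to the indicator of \<open>(0, R)\<close>).\<close>
lemma continuous_approximation:
  fixes k :: "real \<Rightarrow> real"
  assumes [measurable]: "k \<in> borel_measurable borel" and K: "\<And>x. \<bar>k x\<bar> \<le> K"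
    and zero: "\<And>x. x \<notin> {0<..<R} \<Longrightarrow> k x = 0"
  obtains g where "\<And>n. continuous_on UNIV (g n)" "\<And>n x. \<bar>g n x\<bar> \<le> K"
    "\<And>n x. x \<le> 1 / (real n + 1) \<Longrightarrow> g n x = 0" "\<And>n x. R \<le> x \<Longrightarrow> g n x = 0"
    "AE x in lborel. (\<lambda>n. g n x) \<longlonglongrightarrow> k x"
proof -
  have "k measurable_on UNIV"
    by (rule lebesgue_measurable_imp_measurable_on_real) (auto intro: measurable_completion)
  then obtain N h where N: "negligible N" and h: "\<And>n. continuous_on UNIV (h n)"
    and lim: "\<And>x. x \<notin> N \<Longrightarrow> (\<lambda>n. h n x) \<longlonglongrightarrow> k x"
    unfolding measurable_on_def by auto
  have K0: "0 \<le> K" using K[of 0] by linarith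
  define \<theta> where "\<theta> n x = max 0 (min 1 (real n * min x (R - x) - 1))" for n :: nat and x :: real
  define g where "g n x = max (- K) (min K (h n x)) * \<theta> n x" for n x
  have \<theta>: "0 \<le> \<theta> n x" "\<theta> n x \<le> 1" for n x by (auto simp: \<theta>_def)
  have \<theta>_lim: "(\<lambda>n. \<theta> n x) \<longlonglongrightarrow> 1" if x: "0 < x" "x < R" for x
  proof (rule tendsto_eventually)
    let ?m = "min x (R - x)"
    have m: "0 < ?m" using x by simp
    show "\<forall>\<^sub>F n in sequentially. \<theta> n x = 1"
    proof (rule eventually_sequentiallyI)
      fix n assume "nat \<lceil>2 / ?m\<rceil> \<le> n"
      then have "2 / ?m \<le> real n" by linarith
      then show "\<theta> n x = 1" using m by (simp add: \<theta>_def pos_divide_le_eq)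
    qed
  qed
  show ?thesis
  proof
    show "continuous_on UNIV (g n)" for n
      unfolding g_def[abs_def] \<theta>_def by (intro continuous_intros h)
    show "\<bar>g n x\<bar> \<le> K" for n x
    proof -
      have "\<bar>max (- K) (min K (h n x))\<bar> * \<bar>\<theta> n x\<bar> \<le> K * 1"
        using \<theta>[of n x] K0 by (intro mult_mono) auto
      then show ?thesis by (simp add: g_def abs_mult)
    qed
    show "g n x = 0" if "x \<le> 1 / (real n + 1)" for n x
    proof -
      have "real n * min x (R - x) \<le> real n * (1 / (real n + 1))"
        using that by (intro mult_left_mono) auto
      also have "\<dots> \<le> 1" by (simp add: field_simps)
      finally show ?thesis by (simp add: g_def \<theta>_def)
    qed
    show "g n x = 0" if "R \<le> x" for n x
    proof -
      have "real n * min x (R - x) \<le> 0"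
        using that by (intro mult_nonneg_nonpos) auto
      then show ?thesis by (simp add: g_def \<theta>_def)
    qed
    have "(\<lambda>n. g n x) \<longlonglongrightarrow> k x" if "x \<notin> N" for x
    proof (cases "x \<in> {0<..<R}")
      case True
      have "max (- K) (min K (k x)) = k x" using K[of x] by (auto simp: max_def min_def)
      moreover have "(\<lambda>n. g n x) \<longlonglongrightarrow> max (- K) (min K (k x)) * 1"
        unfolding g_def using True that
        by (intro tendsto_mult tendsto_max tendsto_min tendsto_const lim \<theta>_lim) auto
      ultimately show ?thesis by simp
    next
      case False
      have "g n x = 0" for n
      proof -
        have "real n * min x (R - x) \<le> 0"
          using False by (intro mult_nonneg_nonpos) auto
        then show ?thesis by (simp add: g_def \<theta>_def)
      qed
      then show ?thesis using zero[OF False] by simp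
    qed
    moreover have "AE x in lebesgue. x \<notin> N"
      using N by (simp add: negligible_iff_null_sets AE_not_in)
    ultimately show "AE x in lborel. (\<lambda>n. g n x) \<longlonglongrightarrow> k x"
      by (auto simp: AE_completion_iff elim: eventually_mono)
  qed
qed

lemma integrable_dominated:
  fixes f h :: "real \<Rightarrow> real"
  assumes "f \<in> borel_measurable borel" "integrable lborel h" "\<And>x. \<bar>f x\<bar> \<le> h x"
  shows "integrable lborel f"
proof (rule Bochner_Integration.integrable_bound[OF assms(2)])
  show "AE x in lborel. norm (f x) \<le> norm (h x)"
  proof (rule AE_I2)
    fix x
    show "norm (f x) \<le> norm (h x)" using assms(3)[of x] by simp
  qed
qed (use assms(1) in simp)

text \<open>Dominated convergence along continuous approximations \<open>g n\<close> of \<open>k\<close>. Their primitives are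
  bounded only by \<open>M\<close> plus the \<open>L\<^sup>1\<close> error \<open>\<delta> n\<close>, which tends to zero.\<close>
lemma tv_pairing_le_of_test_functions:
  fixes v :: "real \<Rightarrow> real"
  assumes v: "integrable lborel v" "\<And>r. r \<notin> {0<..<R} \<Longrightarrow> v r = 0"
    and R: "0 < R" "R < 1"
    and tv: "\<And>\<phi>. \<phi> \<in> tv_test_functions \<Longrightarrow> (\<integral>r. v r * deriv \<phi> r \<partial>lborel) \<le> V"
  shows "tv_pairing_le v V"
  unfolding tv_pairing_le_def
proof (intro allI impI)
  fix k :: "real \<Rightarrow> real" and K M
  assume k[measurable]: "k \<in> borel_measurable borel" and K: "\<forall>s. \<bar>k s\<bar> \<le> K"
    and M: "\<forall>s\<in>{0..1}. \<bar>\<integral>x. k x * indicator {0..s} x \<partial>lborel\<bar> \<le> M"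
  have v_meas[measurable]: "v \<in> borel_measurable borel"
    using borel_measurable_integrable[OF v(1)] by simp
  define \<kappa> where "\<kappa> x = k x * indicator {0<..<R} x" for x
  have \<kappa>[measurable]: "\<kappa> \<in> borel_measurable borel" unfolding \<kappa>_def[abs_def] by measurable
  have K0: "0 \<le> K" using K[rule_format, of 0] by linarith
  have \<kappa>K: "\<bar>\<kappa> x\<bar> \<le> K" for x using K K0 by (auto simp: \<kappa>_def indicator_def)
  obtain g where g: "\<And>n. continuous_on UNIV (g n)" "\<And>n x. \<bar>g n x\<bar> \<le> K"
    "\<And>n x. x \<le> 1 / (real n + 1) \<Longrightarrow> g n x = 0" "\<And>n x. R \<le> x \<Longrightarrow> g n x = 0"
    "AE x in lborel. (\<lambda>n. g n x) \<longlonglongrightarrow> \<kappa> x"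
    using continuous_approximation[of \<kappa> K R] \<kappa>K by (auto simp: \<kappa>_def)
  have [measurable]: "g n \<in> borel_measurable borel" for n
    using g(1) by (rule borel_measurable_continuous_onI)
  have supp: "\<kappa> x = 0" "g n x = 0" if "x \<notin> {0<..<R}" for n x
  proof -
    show "\<kappa> x = 0" using that by (simp add: \<kappa>_def)
    show "g n x = 0"
    proof (cases "x \<le> 0")
      case True
      then have "x \<le> 1 / (real n + 1)" by (rule order_trans) simp
      then show ?thesis by (rule g(3))
    next
      case False
      then show ?thesis using that by (intro g(4)) auto
    qed
  qed
  have intK: "integrable lborel (\<lambda>x. c * indicator {0<..<R} x)" for c :: real
    using R by (intro integrable_mult_right integrable_real_indicator) auto
  have diff_le: "\<bar>g n x - \<kappa> x\<bar> \<le> 2 * K * indicator {0<..<R} x" for n x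
    using supp(1)[of x] supp(2)[of x n] g(2)[of n x] \<kappa>K[of x] abs_triangle_ineq4[of "g n x" "\<kappa> x"]
    by (auto simp: indicator_def)
  have int_diff: "integrable lborel (\<lambda>x. \<bar>g n x - \<kappa> x\<bar>)" for n
    by (rule integrable_dominated[OF _ intK[of "2 * K"]]) (simp_all add: diff_le)
  have int_\<kappa>: "integrable lborel (\<lambda>x. \<kappa> x * indicator A x)" if [measurable]: "A \<in> sets borel" for A
    by (rule integrable_dominated[OF _ intK[of K]]) (use \<kappa>K supp K0 in \<open>auto simp: indicator_def\<close>)
  have int_g: "integrable lborel (\<lambda>x. g n x * indicator A x)" if [measurable]: "A \<in> sets borel" for A n
    by (rule integrable_dominated[OF _ intK[of K]]) (use g(2) supp K0 in \<open>auto simp: indicator_def\<close>)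
  define \<delta> where "\<delta> n = (\<integral>x. \<bar>g n x - \<kappa> x\<bar> \<partial>lborel)" for n
  have "\<delta> \<longlonglongrightarrow> (\<integral>x. 0 \<partial>(lborel :: real measure))"
    unfolding \<delta>_def[abs_def]
  proof (rule integral_dominated_convergence)
    show "AE x in lborel. (\<lambda>n. \<bar>g n x - \<kappa> x\<bar>) \<longlonglongrightarrow> 0"
      using g(5) by eventually_elim (auto intro: tendsto_rabs_zero simp: LIM_zero)
    show "AE x in lborel. norm \<bar>g n x - \<kappa> x\<bar> \<le> 2 * K * indicator {0<..<R} x" for n
      using diff_le by simp
  qed (use intK in auto)
  then have \<delta>: "\<delta> \<longlonglongrightarrow> 0" by simp
  have \<delta>0: "0 \<le> \<delta> n" for n by (simp add: \<delta>_def)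
  have M0: "0 \<le> M" using order_trans[OF abs_ge_zero M[rule_format, of 0]] by simp
  have \<kappa>M: "\<bar>\<integral>x. \<kappa> x * indicator {0..r} x \<partial>lborel\<bar> \<le> M" for r
  proof (cases "0 \<le> r")
    case True
    have "(\<integral>x. \<kappa> x * indicator {0..r} x \<partial>lborel) = (\<integral>x. k x * indicator {0..min r R} x \<partial>lborel)"
    proof (rule integral_cong_AE)
      show "AE x in lborel. \<kappa> x * indicator {0..r} x = k x * indicator {0..min r R} x"
        using AE_lborel_singleton[of 0] AE_lborel_singleton[of R]
        by eventually_elim (auto simp: \<kappa>_def indicator_def)
    qed auto
    then show ?thesis using M True R by auto
  next
    case False
    then show ?thesis using M0 by simp
  qed
  \<comment> \<open>The last summand keeps the bound positive, so that the test function can be normalised.\<close>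
  have le: "(\<integral>r. v r * g n r \<partial>lborel) \<le> V * (M + \<delta> n + 1 / (real n + 1))" for n
  proof (rule weak_variation_continuous[where a = "1 / (real n + 1)", OF v(2) R tv g(1)])
    show "\<bar>integral {0..r} (g n)\<bar> \<le> M + \<delta> n + 1 / (real n + 1)" for r
    proof -
      have "integral {0..r} (g n) = (\<integral>x. g n x * indicator {0..r} x \<partial>lborel)"
        using set_borel_integral_eq_integral(2)[OF borel_integrable_atLeastAtMost'
            [OF continuous_on_subset[OF g(1)[of n], of "{0..r}"]]]
        by (simp add: set_lebesgue_integral_def mult.commute)
      also have "\<dots> = (\<integral>x. \<kappa> x * indicator {0..r} x \<partial>lborel)
          + (\<integral>x. (g n x - \<kappa> x) * indicator {0..r} x \<partial>lborel)"
        by (simp add: left_diff_distrib int_g int_\<kappa>)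
      finally have "\<bar>integral {0..r} (g n)\<bar>
          \<le> M + \<bar>\<integral>x. (g n x - \<kappa> x) * indicator {0..r} x \<partial>lborel\<bar>"
        using \<kappa>M[of r] by linarith
      also have "\<bar>\<integral>x. (g n x - \<kappa> x) * indicator {0..r} x \<partial>lborel\<bar> \<le> \<delta> n"
        unfolding \<delta>_def
      proof (rule order_trans[OF integral_abs_bound integral_mono[OF _ int_diff]])
        show "integrable lborel (\<lambda>x. \<bar>(g n x - \<kappa> x) * indicator {0..r} x\<bar>)"
          by (rule integrable_dominated[OF _ int_diff[of n]]) (auto simp: indicator_def)
      qed (auto simp: indicator_def)
      finally show ?thesis by (simp add: add_increasing2)
    qed
    show "0 < M + \<delta> n + 1 / (real n + 1)"
      using M0 \<delta>0[of n] by (intro add_nonneg_pos add_nonneg_nonneg) auto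
    show "0 < 1 / (real n + 1)" by simp
  qed (use g(3) in auto)
  have "(\<lambda>n. \<integral>r. v r * g n r \<partial>lborel) \<longlonglongrightarrow> (\<integral>r. v r * k r \<partial>lborel)"
  proof (rule integral_dominated_convergence)
    show "integrable lborel (\<lambda>x. K * \<bar>v x\<bar>)" using v(1) by simp
    show "AE x in lborel. (\<lambda>n. v x * g n x) \<longlonglongrightarrow> v x * k x"
      using g(5)
    proof eventually_elim
      case (elim x)
      have "v x * k x = v x * \<kappa> x" using v(2)[of x] by (auto simp: \<kappa>_def indicator_def)
      then show ?case using tendsto_mult_left[OF elim, of "v x"] by (simp only:)
    qed
    show "AE x in lborel. norm (v x * g n x) \<le> K * \<bar>v x\<bar>" for n
    proof (rule AE_I2)
      fix x
      show "norm (v x * g n x) \<le> K * \<bar>v x\<bar>"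
        using mult_left_mono[OF g(2)[of n x], of "\<bar>v x\<bar>"] by (simp add: abs_mult mult.commute)
    qed
  qed auto
  moreover have "(\<lambda>n. V * (M + \<delta> n + 1 / (real n + 1))) \<longlonglongrightarrow> V * (M + 0 + 0)"
  proof (intro tendsto_intros \<delta>)
    show "(\<lambda>n. 1 / (real n + 1)) \<longlonglongrightarrow> 0"
      using LIMSEQ_inverse_real_of_nat by (simp add: inverse_eq_divide add.commute)
  qed
  ultimately have "(\<integral>r. v r * k r \<partial>lborel) \<le> V * (M + 0 + 0)"
    by (rule LIMSEQ_le) (use le in blast)
  then show "(\<integral>r. v r * k r \<partial>lborel) \<le> V * M" by simp
qed

lemma tv_pairing_le_nonneg: "tv_pairing_le v V \<Longrightarrow> 0 \<le> V"
  using tv_pairing_leD[of v V "\<lambda>_. 0" 0 1] by simp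

lemma tv_pairing_le_uminus: "tv_pairing_le v V \<Longrightarrow> tv_pairing_le (\<lambda>r. - v r) V"
  unfolding tv_pairing_le_def
proof (intro allI impI)
  fix k :: "real \<Rightarrow> real" and K M
  assume v: "\<forall>k K M. k \<in> borel_measurable borel \<longrightarrow> (\<forall>s. \<bar>k s\<bar> \<le> K) \<longrightarrow>
     (\<forall>s\<in>{0..1}. \<bar>\<integral>x. k x * indicator {0..s} x \<partial>lborel\<bar> \<le> M) \<longrightarrow> (\<integral>x. v x * k x \<partial>lborel) \<le> V * M"
    and k: "k \<in> borel_measurable borel" "\<forall>s. \<bar>k s\<bar> \<le> K"
     "\<forall>s\<in>{0..1}. \<bar>\<integral>x. k x * indicator {0..s} x \<partial>lborel\<bar> \<le> M"
  have "(\<integral>x. v x * - k x \<partial>lborel) \<le> V * M"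
    using k by (intro v[rule_format, of "\<lambda>x. - k x" K M]) auto
  then show "(\<integral>x. - v x * k x \<partial>lborel) \<le> V * M" by simp
qed

text \<open>Test with the indicator of the set \<open>E\<close> where \<open>V < v\<close>: its primitive is at most the measure
  of \<open>E\<close>, so \<open>\<integral>\<^sub>E v \<le> V |E|\<close>, which forces \<open>E\<close> to be a null set.\<close>
lemma tv_pairing_le_AE_le:
  assumes v: "integrable lborel v" "\<And>r. r \<notin> {0<..<1} \<Longrightarrow> v r = 0" and tv: "tv_pairing_le v V"
  shows "AE r in lborel. v r \<le> V"
proof -
  have V0: "0 \<le> V" using tv by (rule tv_pairing_le_nonneg)
  have [measurable]: "v \<in> borel_measurable borel"
    using borel_measurable_integrable[OF v(1)] by simp
  let ?E = "{r. V < v r}"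
  have E: "?E \<subseteq> {0<..<1}" using v(2) V0 by (force simp: not_less)
  have [measurable]: "?E \<in> sets borel" by measurable
  have fin: "emeasure lborel ?E < \<infinity>"
    by (rule le_less_trans[OF emeasure_mono[OF E]]) auto
  then have ind: "integrable lborel (indicator ?E :: real \<Rightarrow> real)"
    by (intro integrable_real_indicator) auto
  have "(\<integral>r. v r * (indicator ?E r :: real) \<partial>lborel) \<le> V * (\<integral>r. (indicator ?E r :: real) \<partial>lborel)"
  proof (rule tv_pairing_leD[OF tv])
    fix s :: real
    show "\<bar>\<integral>x. indicator ?E x * indicator {0..s} x \<partial>lborel\<bar> \<le> (\<integral>r. (indicator ?E r :: real) \<partial>lborel)"
    proof (rule order_trans[OF integral_abs_bound integral_mono])
      show "integrable lborel (\<lambda>x. \<bar>indicator ?E x * indicator {0..s} x :: real\<bar>)"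
        by (rule integrable_dominated[OF _ ind]) (auto simp: indicator_def)
    qed (rule ind, auto simp: indicator_def)
  qed (auto simp: indicator_def)
  moreover have int: "integrable lborel (\<lambda>r. v r * indicator ?E r)" "integrable lborel (\<lambda>r. V * indicator ?E r)"
    using v(1) ind by (auto intro: integrable_real_mult_indicator)
  ultimately have "(\<integral>r. v r * indicator ?E r - V * (indicator ?E r :: real) \<partial>lborel) \<le> 0"
    by simp
  moreover have nn: "0 \<le> v r * indicator ?E r - V * indicator ?E r" for r
    by (auto simp: indicator_def)
  ultimately have "(\<integral>r. v r * indicator ?E r - V * (indicator ?E r :: real) \<partial>lborel) = 0"
    by (intro antisym integral_nonneg_AE AE_I2) auto
  then have "AE r in lborel. v r * indicator ?E r - V * indicator ?E r = 0"
    by (subst (asm) integral_nonneg_eq_0_iff_AE) (use int nn in auto)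
  then show ?thesis by eventually_elim (auto simp: indicator_def split: if_splits)
qed

section \<open>The variable \<open>s = r\<^sup>2\<close> on the interval and on the disc\<close>

lemma integral_square_substitution:
  fixes f :: "real \<Rightarrow> real"
  assumes "set_integrable lborel {0..s\<^sup>2} f" "0 \<le> s"
  shows "(\<integral>x. f x * indicator {0..s\<^sup>2} x \<partial>lborel)
    = (\<integral>r. f (r\<^sup>2) * (2 * r) * indicator {0..s} r \<partial>lborel)"
proof -
  have "((\<lambda>r. r\<^sup>2) has_real_derivative 2 * x) (at x)" for x :: real
    by (auto intro!: derivative_eq_intros)
  then show ?thesis
    using integral_substitution(2)[of "\<lambda>r. r\<^sup>2" 0 s f "\<lambda>r. 2 * r"] assms
    by (auto intro!: continuous_intros)
qed

lemma nn_integral_square_substitution: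
  fixes f :: "real \<Rightarrow> real"
  assumes [measurable]: "f \<in> borel_measurable borel"
  shows "(\<integral>\<^sup>+s\<in>{0..1}. ennreal (f s) \<partial>lborel) = (\<integral>\<^sup>+r\<in>{0..1}. ennreal (f (r\<^sup>2) * (2 * r)) \<partial>lborel)"
proof -
  have "((\<lambda>r. r\<^sup>2) has_real_derivative 2 * x) (at x)" for x :: real
    by (auto intro!: derivative_eq_intros)
  then have "(\<integral>\<^sup>+x. ennreal (f x * indicator {0\<^sup>2..1\<^sup>2} x) \<partial>lborel)
      = (\<integral>\<^sup>+x. ennreal (f (x\<^sup>2) * (2 * x) * indicator {0..1} x) \<partial>lborel)"
    by (intro nn_integral_substitution) (auto intro!: continuous_intros simp: set_borel_measurable_def)
  moreover have "ennreal (c * indicator {0..1} x) = ennreal c * indicator {0..1} x" for c x :: real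
    by (simp add: indicator_def)
  ultimately show ?thesis by simp
qed

lemma set_integrable_bounded:
  fixes f :: "real \<Rightarrow> real"
  assumes [measurable]: "f \<in> borel_measurable borel" and "\<And>x. \<bar>f x\<bar> \<le> K"
  shows "set_integrable lborel {a..b} f"
  unfolding set_integrable_def
proof (rule integrable_dominated)
  show "integrable lborel (\<lambda>x. K * indicator {a..b} x)"
    by (cases "a \<le> b") (auto intro!: integrable_mult_right integrable_real_indicator)
  show "\<bar>indicator {a..b} x *\<^sub>R f x\<bar> \<le> K * indicator {a..b} x" for x
    using assms(2)[of x] by (simp add: indicator_def)
qed simp

text \<open>Total variation is invariant under reparametrisation: if \<open>k\<close> is the derivative of a test
  function in the variable \<open>s\<close>, then \<open>2r k(r\<^sup>2)\<close> is that of the same test function in \<open>r\<close>.\<close>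
lemma tv_pairing_le_sqrt:
  assumes v: "v \<in> borel_measurable borel" "\<And>r. \<bar>v r\<bar> \<le> V" "\<And>r. r \<notin> {0<..<1} \<Longrightarrow> v r = 0"
    and tv: "tv_pairing_le v V"
  shows "tv_pairing_le (\<lambda>s. v (sqrt s)) V"
  unfolding tv_pairing_le_def
proof (intro allI impI)
  fix k :: "real \<Rightarrow> real" and K M
  assume k[measurable]: "k \<in> borel_measurable borel" and K: "\<forall>s. \<bar>k s\<bar> \<le> K"
    and M: "\<forall>s\<in>{0..1}. \<bar>\<integral>x. k x * indicator {0..s} x \<partial>lborel\<bar> \<le> M"
  note v(1)[measurable]
  have V0: "0 \<le> V" using tv by (rule tv_pairing_le_nonneg)
  have K0: "0 \<le> K" using K[rule_format, of 0] by linarith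
  have vk: "\<bar>v (sqrt x) * k x\<bar> \<le> V * K" for x
    unfolding abs_mult using v(2) K V0 by (intro mult_mono) auto
  have "(\<integral>x. v (sqrt x) * k x \<partial>lborel) = (\<integral>x. (v (sqrt x) * k x) * indicator {0..1\<^sup>2} x \<partial>lborel)"
  proof (intro Bochner_Integration.integral_cong refl)
    fix x
    show "v (sqrt x) * k x = v (sqrt x) * k x * indicator {0..1\<^sup>2} x"
      using v(3)[of "sqrt x"] by (cases "x \<in> {0..1}") auto
  qed
  also have "\<dots> = (\<integral>r. v (sqrt (r\<^sup>2)) * k (r\<^sup>2) * (2 * r) * indicator {0..1} r \<partial>lborel)"
    by (rule integral_square_substitution) (auto intro!: set_integrable_bounded[OF _ vk])
  also have "\<dots> = (\<integral>r. v r * (k (r\<^sup>2) * (2 * r) * indicator {0..1} r) \<partial>lborel)"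
    by (intro Bochner_Integration.integral_cong) (auto simp: indicator_def)
  also have "\<dots> \<le> V * M"
  proof (rule tv_pairing_leD[OF tv])
    show "\<bar>k (r\<^sup>2) * (2 * r) * indicator {0..1} r\<bar> \<le> K * 2" for r
    proof (cases "r \<in> {0..1}")
      case True
      then have "\<bar>k (r\<^sup>2)\<bar> * \<bar>2 * r\<bar> \<le> K * 2"
        using K K0 by (intro mult_mono) auto
      then show ?thesis using True by (simp add: abs_mult)
    next
      case False
      then show ?thesis using K0 by simp
    qed
    fix s :: real assume s: "s \<in> {0..1}"
    have "(\<integral>x. k (x\<^sup>2) * (2 * x) * indicator {0..1} x * indicator {0..s} x \<partial>lborel)
        = (\<integral>x. k (x\<^sup>2) * (2 * x) * indicator {0..s} x \<partial>lborel)"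
      using s by (intro Bochner_Integration.integral_cong) (auto simp: indicator_def)
    also have "\<dots> = (\<integral>x. k x * indicator {0..s\<^sup>2} x \<partial>lborel)"
      using s K by (intro integral_square_substitution[symmetric] set_integrable_bounded) auto
    finally show "\<bar>\<integral>x. k (x\<^sup>2) * (2 * x) * indicator {0..1} x * indicator {0..s} x \<partial>lborel\<bar> \<le> M"
      using M s by (simp add: power_le_one)
  qed simp
  finally show "(\<integral>x. v (sqrt x) * k x \<partial>lborel) \<le> V * M" .
qed

text \<open>The image of planar Lebesgue measure under the squared norm is \<open>\<pi>\<close> times the measure on
  \<open>[0,1]\<close>, because the disc of squared radius \<open>x\<close> has area \<open>\<pi> * x\<close>.\<close>
lemma nn_integral_ball_radial:
  fixes g :: "real \<Rightarrow> ennreal"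
  assumes [measurable]: "g \<in> borel_measurable borel"
  shows "(\<integral>\<^sup>+p\<in>ball (0::real^2) 1. g ((norm p)\<^sup>2) \<partial>lborel)
    = ennreal pi * (\<integral>\<^sup>+s\<in>{0..1}. g s \<partial>lborel)"
proof -
  let ?B = "ball (0::real^2) 1"
  let ?M = "distr (density lborel (indicator ?B)) borel (\<lambda>p. (norm p)\<^sup>2)"
  let ?N = "density lborel (\<lambda>s. ennreal pi * indicator {0..1::real} s)"
  have vol: "emeasure lborel ?B = ennreal pi"
    "0 \<le> r \<Longrightarrow> emeasure lborel (cball (0::real^2) r) = ennreal (pi * r\<^sup>2)" for r
    by (simp_all add: emeasure_ball emeasure_cball unit_ball_vol_2)
  have M: "emeasure ?M {x<..} = emeasure lborel (?B \<inter> {p. x < (norm p)\<^sup>2})" for x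
    by (subst emeasure_distr) (auto simp: emeasure_restricted vimage_def)
  have N: "emeasure ?N {x<..} = ennreal pi * emeasure lborel ({0..1} \<inter> {x<..})" for x
    by (simp add: emeasure_density nn_integral_cmult mult.assoc flip: indicator_inter_arith)
  have "?M = ?N"
  proof (rule measure_eqI_lessThan)
    fix x
    have "emeasure ?M {x<..} \<le> emeasure lborel ?B"
      unfolding M by (rule emeasure_mono) auto
    then show "emeasure ?M {x<..} < \<infinity>" by (simp add: vol le_less_trans)
    consider "x < 0" | "0 \<le> x" "x < 1" | "1 \<le> x" by linarith
    then show "emeasure ?M {x<..} = emeasure ?N {x<..}"
    proof cases
      case 1
      then have "?B \<inter> {p. x < (norm p)\<^sup>2} = ?B" "{0..1} \<inter> {x<..} = {0..1}"
        by (auto intro: less_le_trans)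
      then show ?thesis unfolding M N by (simp add: vol)
    next
      case 2
      have "?B \<inter> {p. x < (norm p)\<^sup>2} = ?B - cball 0 (sqrt x)"
      proof -
        have "norm p \<le> sqrt x \<longleftrightarrow> (norm p)\<^sup>2 \<le> x" for p :: "real^2"
          using real_sqrt_le_iff[of "(norm p)\<^sup>2" x] by simp
        then show ?thesis by (auto simp: not_le)
      qed
      moreover have "cball 0 (sqrt x) \<subseteq> ?B"
      proof
        fix p :: "real^2" assume "p \<in> cball 0 (sqrt x)"
        then have "norm p \<le> sqrt x" by simp
        also have "\<dots> < 1" using 2 by simp
        finally show "p \<in> ?B" by simp
      qed
      ultimately have "emeasure lborel (?B \<inter> {p. x < (norm p)\<^sup>2}) = ennreal pi - ennreal (pi * x)"
        using 2 vol by (simp add: emeasure_Diff)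
      also have "\<dots> = ennreal (pi - pi * x)"
        using 2 by (intro ennreal_minus) simp
      also have "pi - pi * x = pi * (1 - x)"
        by (simp add: right_diff_distrib)
      also have "ennreal (pi * (1 - x)) = ennreal pi * ennreal (1 - x)"
        using 2 by (intro ennreal_mult) auto
      also have "ennreal (1 - x) = emeasure lborel ({0..1} \<inter> {x<..})"
      proof -
        have "{0..1} \<inter> {x<..} = {x<..1}" using 2 by auto
        then show ?thesis using 2 by simp
      qed
      finally show ?thesis unfolding M N .
    next
      case 3
      have n: "(norm p)\<^sup>2 \<le> x" if "norm p < 1" for p :: "real^2"
        using 3 power_le_one[of "norm p" 2] that by simp
      then have "?B \<inter> {p. x < (norm p)\<^sup>2} = {}" "{0..1} \<inter> {x<..} = {}"
        using 3 by (auto dest!: n)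
      then show ?thesis unfolding M N by simp
    qed
  qed simp_all
  have "(\<integral>\<^sup>+p\<in>?B. g ((norm p)\<^sup>2) \<partial>lborel) = integral\<^sup>N ?M g"
    by (subst nn_integral_distr, simp, simp, subst nn_integral_density)
      (auto simp: mult.commute intro!: borel_measurable_indicator)
  also have "\<dots> = integral\<^sup>N ?N g" by (simp only: \<open>?M = ?N\<close>)
  also have "\<dots> = ennreal pi * (\<integral>\<^sup>+s\<in>{0..1}. g s \<partial>lborel)"
    by (subst nn_integral_density) (auto simp: mult_ac nn_integral_cmult)
  finally show ?thesis .
qed

text \<open>A null set \<open>N\<close> of radii sweeps out a planar set of measure \<open>\<integral>\<^sub>N 2\<pi>r dr = 0\<close>, so the profile may
  be replaced by an almost everywhere equal one.\<close>
lemma AE_ball_norm: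
  fixes P :: "real \<Rightarrow> bool"
  assumes "AE r in lborel. P r"
  shows "AE p in lborel. p \<in> ball (0::real^2) 1 \<longrightarrow> P (norm p)"
proof -
  obtain N where N: "{r. \<not> P r} \<subseteq> N" "N \<in> null_sets lborel"
    using assms by (auto simp: eventually_ae_filter)
  have [measurable]: "N \<in> sets borel" using N(2) by auto
  have "(\<integral>\<^sup>+p\<in>ball (0::real^2) 1. indicator N (norm p) \<partial>lborel)
      = (\<integral>\<^sup>+p\<in>ball (0::real^2) 1. ennreal (indicator N (sqrt ((norm p)\<^sup>2))) \<partial>lborel)"
    by (simp add: ennreal_indicator)
  also have "\<dots> = ennreal pi * (\<integral>\<^sup>+s\<in>{0..1}. ennreal (indicator N (sqrt s)) \<partial>lborel)"
    by (rule nn_integral_ball_radial) measurable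
  also have "(\<integral>\<^sup>+s\<in>{0..1}. ennreal (indicator N (sqrt s)) \<partial>lborel)
      = (\<integral>\<^sup>+r\<in>{0..1}. ennreal (indicator N (sqrt (r\<^sup>2)) * (2 * r)) \<partial>lborel)"
    by (rule nn_integral_square_substitution) measurable
  also have "\<dots> = (\<integral>\<^sup>+r. 0 \<partial>(lborel :: real measure))"
  proof (rule nn_integral_cong_AE)
    show "AE r in lborel. ennreal (indicator N (sqrt (r\<^sup>2)) * (2 * r)) * indicator {0..1} r = 0"
      using AE_not_in[OF N(2)] by eventually_elim (auto simp: indicator_def)
  qed
  finally have "(\<integral>\<^sup>+p\<in>ball (0::real^2) 1. indicator N (norm p) \<partial>lborel) = 0" by simp
  then have "AE p in lborel. indicator N (norm p) * indicator (ball (0::real^2) 1) p = (0 :: ennreal)"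
    using measurable_compose[OF borel_measurable_norm
        borel_measurable_indicator[OF \<open>N \<in> sets borel\<close>]]
    by (subst (asm) nn_integral_0_iff_AE) (auto intro!: borel_measurable_times_ennreal borel_measurable_indicator)
  then show ?thesis
    by eventually_elim (use N(1) in \<open>auto simp: indicator_def split: if_splits\<close>)
qed

section \<open>The estimate for the Abel transform\<close>

text \<open>A Borel representative of the profile, truncated at its essential bound and set to zero
  outside \<open>(0,1)\<close>, so that the pointwise bounds hold for every radius.\<close>
lemma BV_representative:
  assumes BV: "BV v" and supp: "closure {r. v r \<noteq> 0} \<subseteq> {0..<1}"
  defines "V \<equiv> enn2real (TV_norm v)"
  obtains v0 where "v \<in> borel_measurable lebesgue" "v0 \<in> borel_measurable borel"
    "\<And>r. \<bar>v0 r\<bar> \<le> V" "\<And>r. r \<notin> {0<..<1} \<Longrightarrow> v0 r = 0" "AE r in lborel. v r = v0 r"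
    "tv_pairing_le v0 V"
proof -
  have TV: "TV_norm v = ennreal V"
    using BV by (simp add: BV_def V_def)
  have V0: "0 \<le> V" by (simp add: V_def)
  obtain R where R: "0 < R" "R < 1" and vR: "\<And>r. r \<notin> {0..<R} \<Longrightarrow> v r = 0"
  proof -
    let ?S = "insert 0 (closure {r. v r \<noteq> 0})"
    have "bounded ?S"
      unfolding bounded_insert
      by (rule bounded_subset[OF bounded_closed_interval[of 0 1]]) (use supp in auto)
    then have "compact ?S" by (simp add: compact_eq_bounded_closed)
    then obtain m where m: "m \<in> ?S" "\<And>r. r \<in> ?S \<Longrightarrow> r \<le> m"
      using compact_attains_sup[of ?S] by blast
    have "m \<in> {0..<1}" using m(1) supp by auto
    then have m01: "0 \<le> m" "m < 1" by auto
    show ?thesis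
    proof (rule that[of "(1 + m) / 2"])
      fix r assume r: "r \<notin> {0..<(1 + m) / 2}"
      show "v r = 0"
      proof (rule ccontr)
        assume "v r \<noteq> 0"
        then have "r \<in> closure {r. v r \<noteq> 0}" using subsetD[OF closure_subset, of r "{r. v r \<noteq> 0}"] by simp
        then have "r \<le> m" "0 \<le> r" using m(2)[of r] subsetD[OF supp, of r] by auto
        then show False using r m01 by simp
      qed
    qed (use m01 in auto)
  qed
  have vi: "integrable lebesgue (\<lambda>r. indicator {0<..<1} r * v r)"
    using BV by (simp add: BV_def set_integrable_def)
  have v_meas: "v \<in> borel_measurable lebesgue"
  proof -
    have "(\<lambda>r. indicator {0<..<1} r * v r + v 0 * indicator {0} r) \<in> borel_measurable lebesgue"
      by (intro borel_measurable_add borel_measurable_integrable[OF vi]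
          borel_measurable_times[OF borel_measurable_const borel_measurable_indicator]) auto
    moreover have "(\<lambda>r. indicator {0<..<1} r * v r + v 0 * indicator {0} r) = v"
    proof
      fix r
      have "v r = 0" if "r \<notin> {0<..<1}" "r \<noteq> 0"
        using that R by (intro vR) auto
      then show "indicator {0<..<1} r * v r + v 0 * indicator {0} r = v r"
        by (cases "r = 0"; cases "r \<in> {0<..<1}") auto
    qed
    ultimately show ?thesis by (simp only:)
  qed
  obtain v1 where [measurable]: "v1 \<in> borel_measurable borel" and v1: "AE r in lborel. v r = v1 r"
    using completion_ex_borel_measurable_real[OF v_meas] by auto
  define v2 where "v2 r = v1 r * indicator {0<..<R} r" for r
  have v2_meas[measurable]: "v2 \<in> borel_measurable borel"
    unfolding v2_def[abs_def] by measurable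
  have v2: "AE r in lborel. v r = v2 r"
    using v1 AE_lborel_singleton[of 0]
  proof eventually_elim
    case (elim r)
    then show ?case using vR[of r] by (cases "r \<in> {0<..<R}") (auto simp: v2_def)
  qed
  have v2_supp: "v2 r = 0" if "r \<notin> {0<..<R}" for r using that by (simp add: v2_def)
  have v2_supp1: "v2 r = 0" if "r \<notin> {0<..<1}" for r using that R by (intro v2_supp) auto
  have "integrable lebesgue v2"
  proof (rule integrable_cong_AE_imp[OF vi])
    show "AE r in lebesgue. indicator {0<..<1} r * v r = v2 r"
      using AE_completion[OF v2]
      by eventually_elim (use v2_supp1 in \<open>auto simp: indicator_def\<close>)
  qed (simp add: measurable_completion)
  then have v2_int: "integrable lborel v2" by (simp add: integrable_completion)
  have pairing: "tv_pairing_le v2 V"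
  proof (rule tv_pairing_le_of_test_functions[OF v2_int v2_supp R])
    fix \<phi> :: "real \<Rightarrow> real" assume \<phi>: "\<phi> \<in> tv_test_functions"
    then obtain D where D: "\<And>x. (\<phi> has_vector_derivative D x) (at x)" "continuous_on UNIV D"
      by (auto simp: tv_test_functions_def C1_differentiable_on_def)
    have d: "deriv \<phi> = D"
      using D(1) by (auto intro!: ext DERIV_imp_deriv simp: has_real_derivative_iff_has_vector_derivative)
    have [measurable]: "deriv \<phi> \<in> borel_measurable borel"
      unfolding d using D(2) by (rule borel_measurable_continuous_onI)
    have "(LINT r:{0<..<1}|lebesgue. v r * deriv \<phi> r) = (\<integral>r. v2 r * deriv \<phi> r \<partial>lebesgue)"
      unfolding set_lebesgue_integral_def
    proof (rule integral_cong_AE)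
      show "AE r in lebesgue. indicator {0<..<1} r *\<^sub>R (v r * deriv \<phi> r) = v2 r * deriv \<phi> r"
        using AE_completion[OF v2]
        by eventually_elim (use v2_supp1 in \<open>auto simp: indicator_def\<close>)
      have "deriv \<phi> \<in> borel_measurable lebesgue" by (simp add: measurable_completion)
      then show "(\<lambda>r. indicator {0<..<1} r *\<^sub>R (v r * deriv \<phi> r)) \<in> borel_measurable lebesgue"
        using v_meas by (intro borel_measurable_scaleR borel_measurable_times borel_measurable_indicator) auto
    qed (simp add: measurable_completion)
    also have "\<dots> = (\<integral>r. v2 r * deriv \<phi> r \<partial>lborel)"
      by (rule integral_completion) simp
    finally have "ennreal (\<integral>r. v2 r * deriv \<phi> r \<partial>lborel) \<le> TV_norm v"
      unfolding TV_norm_def by (intro SUP_upper2[OF \<phi>]) simp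
    then show "(\<integral>r. v2 r * deriv \<phi> r \<partial>lborel) \<le> V"
      using V0 by (simp add: TV)
  qed
  have bd: "AE r in lborel. \<bar>v2 r\<bar> \<le> V"
  proof -
    have "AE r in lborel. - v2 r \<le> V"
      by (rule tv_pairing_le_AE_le[OF _ _ tv_pairing_le_uminus[OF pairing]])
        (simp_all add: v2_int v2_supp1)
    moreover have "AE r in lborel. v2 r \<le> V"
      by (rule tv_pairing_le_AE_le[OF v2_int _ pairing]) (rule v2_supp1)
    ultimately show ?thesis
      by eventually_elim simp
  qed
  define v0 where "v0 r = max (- V) (min V (v2 r))" for r
  have v0_meas[measurable]: "v0 \<in> borel_measurable borel"
    unfolding v0_def[abs_def] by measurable
  have v0: "AE r in lborel. v2 r = v0 r"
    using bd by eventually_elim (auto simp: v0_def)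
  show ?thesis
  proof (rule that[OF v_meas v0_meas])
    show "\<bar>v0 r\<bar> \<le> V" for r using V0 by (auto simp: v0_def)
    show "v0 r = 0" if "r \<notin> {0<..<1}" for r using v2_supp1[OF that] V0 by (simp add: v0_def)
    show "AE r in lborel. v r = v0 r" using v2 v0 by eventually_elim simp
    show "tv_pairing_le v0 V"
      unfolding tv_pairing_le_def
    proof (intro allI impI)
      fix k :: "real \<Rightarrow> real" and K M
      assume [measurable]: "k \<in> borel_measurable borel" and k: "\<forall>s. \<bar>k s\<bar> \<le> K"
        "\<forall>s\<in>{0..1}. \<bar>\<integral>x. k x * indicator {0..s} x \<partial>lborel\<bar> \<le> M"
      have "(\<integral>x. v0 x * k x \<partial>lborel) = (\<integral>x. v2 x * k x \<partial>lborel)"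
        by (rule integral_cong_AE) (use v0 in \<open>auto elim: eventually_mono\<close>)
      also have "\<dots> \<le> V * M" using k by (intro tv_pairing_leD[OF pairing]) auto
      finally show "(\<integral>x. v0 x * k x \<partial>lborel) \<le> V * M" .
    qed
  qed
qed

text \<open>The factor \<open>2r\<close> of the Abel transform is the Jacobian of \<open>s = r\<^sup>2\<close>.\<close>
lemma abel_transform_eq_half_integral:
  assumes v: "v \<in> borel_measurable lebesgue" "AE r in lborel. v r = v0 r"
    and v0[measurable]: "v0 \<in> borel_measurable borel"
    and bound: "\<And>r. \<bar>v0 r\<bar> \<le> V" and supp: "\<And>r. r \<notin> {0<..<1} \<Longrightarrow> v0 r = 0"
    and x: "0 \<le> x"
  shows "abel_transform v x = half_integral (\<lambda>s. v0 (sqrt s)) (x\<^sup>2)"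
proof -
  let ?w = "\<lambda>s. v0 (sqrt s)"
  \<comment> \<open>An integrable kernel that majorises the integrand: \<open>s - x\<^sup>2 < 2\<close> for \<open>s\<close> in \<open>[0,1]\<close>.\<close>
  let ?q = "\<lambda>y. abel_kernel y * indicator {0<..<2} y"
  have "abel_transform v x = 2 * (\<integral>r. indicator {x<..} r *\<^sub>R (v0 r * r / sqrt (r\<^sup>2 - x\<^sup>2)) \<partial>lebesgue)"
    unfolding abel_transform_def set_lebesgue_integral_def
  proof (intro arg_cong[where f = "\<lambda>I. 2 * I"] integral_cong_AE)
    have "(\<lambda>r. indicator {x<..} r * (r / sqrt (r\<^sup>2 - x\<^sup>2))) \<in> borel_measurable lborel" by measurable
    then have "(\<lambda>r. v r * (indicator {x<..} r * (r / sqrt (r\<^sup>2 - x\<^sup>2)))) \<in> borel_measurable lebesgue"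
      by (intro borel_measurable_times[OF v(1)] measurable_completion)
    then show "(\<lambda>r. indicator {x<..} r *\<^sub>R (v r * r / sqrt (r\<^sup>2 - x\<^sup>2))) \<in> borel_measurable lebesgue"
      by (simp add: mult_ac)
    show "(\<lambda>r. indicator {x<..} r *\<^sub>R (v0 r * r / sqrt (r\<^sup>2 - x\<^sup>2))) \<in> borel_measurable lebesgue"
      by (intro measurable_completion) measurable
    show "AE r in lebesgue. indicator {x<..} r *\<^sub>R (v r * r / sqrt (r\<^sup>2 - x\<^sup>2))
        = indicator {x<..} r *\<^sub>R (v0 r * r / sqrt (r\<^sup>2 - x\<^sup>2))"
      using AE_completion[OF v(2)] by eventually_elim simp
  qed
  also have "(\<integral>r. indicator {x<..} r *\<^sub>R (v0 r * r / sqrt (r\<^sup>2 - x\<^sup>2)) \<partial>lebesgue)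
      = (\<integral>r. indicator {x<..} r * (v0 r * r / sqrt (r\<^sup>2 - x\<^sup>2)) \<partial>lborel)"
    by (subst integral_completion) auto
  also have "2 * (\<integral>r. indicator {x<..} r * (v0 r * r / sqrt (r\<^sup>2 - x\<^sup>2)) \<partial>lborel)
      = (\<integral>r. 2 * (indicator {x<..} r * (v0 r * r / sqrt (r\<^sup>2 - x\<^sup>2))) \<partial>lborel)"
    by (rule integral_mult_right_zero[symmetric])
  also have "\<dots> = (\<integral>r. ?w (r\<^sup>2) * abel_kernel (r\<^sup>2 - x\<^sup>2) * (2 * r) * indicator {0..1} r \<partial>lborel)"
  proof (intro Bochner_Integration.integral_cong refl)
    fix r
    show "2 * (indicator {x<..} r * (v0 r * r / sqrt (r\<^sup>2 - x\<^sup>2)))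
        = ?w (r\<^sup>2) * abel_kernel (r\<^sup>2 - x\<^sup>2) * (2 * r) * indicator {0..1} r"
    proof (cases "r \<in> {0<..<1}")
      case True
      then have "(x\<^sup>2 < r\<^sup>2) = (x < r)" using x power_mono_iff[of r x 2] by (simp flip: not_le)
      then show ?thesis using True by (auto simp: abel_kernel_def indicator_def)
    next
      case False
      then show ?thesis using supp[of r] by (cases "0 \<le> r") (auto simp: indicator_def)
    qed
  qed
  also have "\<dots> = (\<integral>s. ?w s * abel_kernel (s - x\<^sup>2) * indicator {0..1\<^sup>2} s \<partial>lborel)"
  proof (rule integral_square_substitution[symmetric])
    have "integrable lborel ?q"
    proof (rule integrableI_nonneg)
      have "(\<integral>\<^sup>+y. ennreal (?q y) \<partial>lborel) = (\<integral>\<^sup>+y\<in>{0<..<2}. ennreal (abel_kernel y) \<partial>lborel)"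
        by (rule nn_integral_cong) (auto simp: indicator_def)
      then show "(\<integral>\<^sup>+y. ennreal (?q y) \<partial>lborel) < \<infinity>"
        using nn_integral_abel_kernel[of 2] by simp
    qed auto
    from lborel_integrable_real_affine[OF this, of 1 "- (x\<^sup>2)"]
    have "integrable lborel (\<lambda>s. V * ?q (s - x\<^sup>2))" by simp
    then show "set_integrable lborel {0..1\<^sup>2} (\<lambda>s. ?w s * abel_kernel (s - x\<^sup>2))"
      unfolding set_integrable_def
    proof (rule integrable_dominated[rotated])
      fix s
      have "\<bar>v0 (sqrt s)\<bar> * abel_kernel (s - x\<^sup>2) \<le> V * abel_kernel (s - x\<^sup>2)"
        by (intro mult_right_mono bound) simp
      moreover have "0 \<le> V * abel_kernel (s - x\<^sup>2)"
        using bound[of 0] by (intro mult_nonneg_nonneg) auto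
      moreover have "s - x\<^sup>2 < 2" if "s \<le> 1"
        using that zero_le_power2[of x] by linarith
      ultimately show "\<bar>indicator {0..1\<^sup>2} s *\<^sub>R (?w s * abel_kernel (s - x\<^sup>2))\<bar> \<le> V * ?q (s - x\<^sup>2)"
        by (auto simp: indicator_def abs_mult abel_kernel_def)
    qed measurable
  qed simp
  also have "\<dots> = half_integral ?w (x\<^sup>2)"
    unfolding half_integral_def
  proof (intro Bochner_Integration.integral_cong refl)
    fix s
    show "?w s * abel_kernel (s - x\<^sup>2) * indicator {0..1\<^sup>2} s = ?w s * abel_kernel (s - x\<^sup>2)"
      using supp[of "sqrt s"] by (cases "s \<in> {0..1}") auto
  qed
  finally show ?thesis .
qed

lemma ennreal_sqrt_ennreal: "0 \<le> a \<Longrightarrow> ennreal_sqrt (ennreal a) = ennreal (sqrt a)"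
  by (simp add: ennreal_sqrt_def)

lemma axisymmetric_eq_radial_profile:
  assumes "axisymmetric u" "p \<in> ball 0 1"
  shows "u p = radial_profile u (norm p)"
proof -
  obtain v where v: "\<And>p. p \<in> ball 0 1 \<Longrightarrow> u p = v (norm p)"
    using assms(1) by (auto simp: axisymmetric_def)
  have "norm (norm p *\<^sub>R (axis 1 1 :: real^2)) = norm p" by (simp add: norm_axis_1)
  moreover from this have "norm p *\<^sub>R (axis 1 1 :: real^2) \<in> ball 0 1"
    using assms(2) by (simp only: mem_ball_0)
  ultimately have "u (norm p *\<^sub>R axis 1 1) = v (norm p)" using v by metis
  then show ?thesis using assms(2) v[OF assms(2)] by (simp add: radial_profile_def)
qed

theorem theorem3p10:
  "\<exists>C\<ge>(0::real). \<forall>(u :: real^2 \<Rightarrow> real) (f :: real \<Rightarrow> real).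
     axisymmetric u \<longrightarrow>
     BV (radial_profile u) \<longrightarrow>
     closure {r. radial_profile u r \<noteq> 0} \<subseteq> {0..<1} \<longrightarrow>
     (\<forall>x\<ge>0. abel_transform (radial_profile u) x = f x) \<longrightarrow>
     L2_norm (ball 0 1) u
       \<le> ennreal C * ennreal_sqrt (TV_norm (radial_profile u)) * ennreal_sqrt (L2_norm {0<..<1} f)"
proof (intro exI[of _ "sqrt (6 * sqrt 2 * pi)"] conjI allI impI)
  fix u :: "real^2 \<Rightarrow> real" and f :: "real \<Rightarrow> real"
  let ?v = "radial_profile u" and ?C = "sqrt (6 * sqrt 2 * pi)"
  assume u: "axisymmetric u" and BV: "BV ?v" and supp: "closure {r. ?v r \<noteq> 0} \<subseteq> {0..<1}"
    and f: "\<forall>x\<ge>0. abel_transform ?v x = f x"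
  define V where "V = enn2real (TV_norm ?v)"
  have TV: "TV_norm ?v = ennreal V" using BV by (simp add: BV_def V_def)
  obtain v0 where v: "?v \<in> borel_measurable lebesgue" and v0[measurable]: "v0 \<in> borel_measurable borel"
    and v0_bound: "\<And>r. \<bar>v0 r\<bar> \<le> V" and v0_supp: "\<And>r. r \<notin> {0<..<1} \<Longrightarrow> v0 r = 0"
    and ae: "AE r in lborel. ?v r = v0 r" and pairing: "tv_pairing_le v0 V"
    by (rule BV_representative[OF BV supp, folded V_def]) (rule that)
  define w where "w s = v0 (sqrt s)" for s
  interpret bounded_profile w V
  proof
    show "w s = 0" if "s \<notin> {0<..<1}" for s
      unfolding w_def using that by (intro v0_supp) auto
  qed (auto simp: w_def[abs_def] v0_bound)
  have w_pairing: "tv_pairing_le w V"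
    unfolding w_def[abs_def] by (rule tv_pairing_le_sqrt[OF v0 v0_bound v0_supp pairing])
  have u_norm: "L2_norm (ball 0 1) u = ennreal (sqrt (pi * (\<integral>s. (w s)\<^sup>2 \<partial>lborel)))"
  proof -
    have "(\<integral>\<^sup>+p\<in>ball 0 1. ennreal (\<bar>u p\<bar>\<^sup>2) \<partial>lebesgue)
        = (\<integral>\<^sup>+p\<in>ball (0::real^2) 1. ennreal ((w ((norm p)\<^sup>2))\<^sup>2) \<partial>lborel)"
      unfolding nn_integral_completion
      by (rule nn_integral_cong_AE, use AE_ball_norm[OF ae] in eventually_elim)
        (auto simp: indicator_def w_def axisymmetric_eq_radial_profile[OF u])
    also have "\<dots> = ennreal pi * (\<integral>\<^sup>+s\<in>{0..1}. ennreal ((w s)\<^sup>2) \<partial>lborel)"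
      by (rule nn_integral_ball_radial) measurable
    also have "(\<integral>\<^sup>+s\<in>{0..1}. ennreal ((w s)\<^sup>2) \<partial>lborel) = (\<integral>\<^sup>+s. ennreal ((w s)\<^sup>2) \<partial>lborel)"
    proof (rule nn_integral_cong)
      fix s
      show "ennreal ((w s)\<^sup>2) * indicator {0..1} s = ennreal ((w s)\<^sup>2)"
        using w_support[of s] by (cases "s \<in> {0..1}") auto
    qed
    also have "\<dots> = ennreal (\<integral>s. (w s)\<^sup>2 \<partial>lborel)"
      by (rule nn_integral_eq_integral[OF integrable_w_square]) simp
    finally show ?thesis
      by (simp add: L2_norm_def ennreal_sqrt_ennreal flip: ennreal_mult)
  qed
  define J where "J = (\<integral>\<^sup>+x\<in>{0<..<1}. ennreal (\<bar>f x\<bar>\<^sup>2) \<partial>lborel)"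
  have f_norm: "L2_norm {0<..<1} f = ennreal_sqrt J"
    by (simp add: L2_norm_def nn_integral_completion J_def)
  have half: "half_integral w (x\<^sup>2) = f x" if "0 \<le> x" for x
    using abel_transform_eq_half_integral[OF v ae v0 v0_bound v0_supp that] f that
    by (simp add: w_def[abs_def])
  \<comment> \<open>The Jacobian \<open>2x\<close> is at most \<open>2\<close> on \<open>(0,1)\<close>.\<close>
  have F: "(\<integral>\<^sup>+t\<in>{0<..<1}. ennreal ((half_integral w t)\<^sup>2) \<partial>lborel) \<le> 2 * J"
  proof -
    have "(\<integral>\<^sup>+t\<in>{0<..<1}. ennreal ((half_integral w t)\<^sup>2) \<partial>lborel)
        \<le> (\<integral>\<^sup>+t\<in>{0..1}. ennreal ((half_integral w t)\<^sup>2) \<partial>lborel)"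
      by (intro nn_integral_mono) (auto simp: indicator_def)
    also have "\<dots> = (\<integral>\<^sup>+x\<in>{0..1}. ennreal ((half_integral w (x\<^sup>2))\<^sup>2 * (2 * x)) \<partial>lborel)"
      by (rule nn_integral_square_substitution) measurable
    also have "\<dots> \<le> (\<integral>\<^sup>+x. ennreal 2 * (ennreal ((half_integral w (x\<^sup>2))\<^sup>2) * indicator {0<..<1} x) \<partial>lborel)"
    proof (rule nn_integral_mono_AE)
      show "AE x in lborel. ennreal ((half_integral w (x\<^sup>2))\<^sup>2 * (2 * x)) * indicator {0..1} x
          \<le> ennreal 2 * (ennreal ((half_integral w (x\<^sup>2))\<^sup>2) * indicator {0<..<1} x)"
        using AE_lborel_singleton[of 0] AE_lborel_singleton[of 1]
      proof eventually_elim
        case (elim x)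
        show ?case
        proof (cases "x \<in> {0<..<1}")
          case True
          have "(half_integral w (x\<^sup>2))\<^sup>2 * (2 * x) \<le> (half_integral w (x\<^sup>2))\<^sup>2 * 2"
            using True by (intro mult_left_mono) auto
          then have "ennreal ((half_integral w (x\<^sup>2))\<^sup>2 * (2 * x)) \<le> ennreal (2 * (half_integral w (x\<^sup>2))\<^sup>2)"
            by (intro ennreal_leI) (simp add: mult.commute)
          also have "\<dots> = ennreal 2 * ennreal ((half_integral w (x\<^sup>2))\<^sup>2)"
            by (rule ennreal_mult) auto
          finally show ?thesis using True by simp
        next
          case False
          then have "x \<notin> {0..1}" using elim by auto
          then show ?thesis by simp
        qed
      qed
    qed
    also have "\<dots> = ennreal 2 * (\<integral>\<^sup>+x\<in>{0<..<1}. ennreal ((half_integral w (x\<^sup>2))\<^sup>2) \<partial>lborel)"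
      by (rule nn_integral_cmult) measurable
    also have "(\<integral>\<^sup>+x\<in>{0<..<1}. ennreal ((half_integral w (x\<^sup>2))\<^sup>2) \<partial>lborel) = J"
      unfolding J_def by (intro nn_integral_cong) (auto simp: indicator_def half)
    finally show ?thesis by simp
  qed
  show "L2_norm (ball 0 1) u \<le> ennreal ?C * ennreal_sqrt (TV_norm ?v) * ennreal_sqrt (L2_norm {0<..<1} f)"
  proof (cases "J = \<infinity>")
    case True
    show ?thesis
    proof (cases "V = 0")
      case True
      then have "w s = 0" for s using w_bound[of s] by simp
      then show ?thesis unfolding u_norm by simp
    next
      case False
      then have "0 < V" using V_nonneg by simp
      with True show ?thesis
        unfolding f_norm TV by (simp add: ennreal_sqrt_ennreal)
          (simp add: ennreal_sqrt_def ennreal_mult_eq_top_iff)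
    qed
  next
    case False
    then obtain j where j: "J = ennreal j" "0 \<le> j" by (cases J) auto
    have "(\<integral>s. (w s)\<^sup>2 \<partial>lborel) \<le> 6 * V * sqrt (2 * j)"
    proof (rule integral_square_le[OF w_pairing])
      have "2 * J = ennreal ((sqrt (2 * j))\<^sup>2)"
        using j by (simp add: ennreal_mult)
      with F show "(\<integral>\<^sup>+t\<in>{0<..<1}. ennreal ((half_integral w t)\<^sup>2) \<partial>lborel) \<le> ennreal ((sqrt (2 * j))\<^sup>2)"
        by simp
    qed (use j in simp)
    then have "pi * (\<integral>s. (w s)\<^sup>2 \<partial>lborel) \<le> (6 * sqrt 2 * pi) * V * sqrt j"
      using mult_left_mono[of _ _ pi] by (simp add: real_sqrt_mult mult_ac)
    then have "sqrt (pi * (\<integral>s. (w s)\<^sup>2 \<partial>lborel)) \<le> ?C * sqrt V * sqrt (sqrt j)"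
      by (simp flip: real_sqrt_mult)
    then show ?thesis
      unfolding u_norm f_norm TV using j V_nonneg
      by (simp add: ennreal_sqrt_ennreal ennreal_leI flip: ennreal_mult)
  qed
qed simp

end
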